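(* Assume that $V\in C^1(\mathbb{R}^N)$ satisfies (V3) $V$ has a strict local minimum at $x_0:=0$ with value $V(0)=0$: there exists $r_0>0$ such that $V(x)>0$ for any $x\in\overline{B_{4r_0}(0)}\setminus\{0\}$; (V4) the set $\mathcal{C}_0:=\{x\in\mathbb{R}^N:V(x)>0\}\cup\{0\}$ is bounded, and $\nabla V(x)\ne0$ for any $x\in\partial\mathcal{C}_0$. If $c\ge0$ is such that condition $(\mathbf{V}^c)$ holds true (with sets $\mathcal{V}^c_-,\mathcal{V}^c_+$), then there exists a solution $q_c\in C^2(\mathbb{R},\mathbb{R}^N)$ of $\ddot q=\nabla V(q)$ on $\mathbb{R}$ such that $$\inf_{t\in\mathbb{R}}\mathrm{dist}(q_c(t),\mathcal{V}^c_-)=\inf_{t\in\mathbb{R}}\mathrm{dist}(q_c(t),\mathcal{V}^c_+)=0$$ with energy $E_{q_c}(t):=\tfrac12|\dot q_c(t)|^2-V(q_c(t))=-c$ for all $t\in\mathbb{R}$.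
   Context: $N\ge2$ is an integer. $\mathrm{dist}$ denotes Euclidean distance (point to set, or between sets, as an infimum); $B_r(x)$ is the open ball. $\mathcal{V}^c:=\{x\in\mathbb{R}^N:V(x)\le c\}$. Condition $(\mathbf{V}^c)$: there exist nonempty closed sets $\mathcal{V}^c_-,\mathcal{V}^c_+\subset\mathbb{R}^N$ such that $\mathcal{V}^c=\mathcal{V}^c_-\cup\mathcal{V}^c_+$ and $\mathrm{dist}(\mathcal{V}^c_-,\mathcal{V}^c_+)>0$. *)

theory Defs
  imports "HOL-Analysis.Analysis"
begin

definition grad :: "('a::real_inner \<Rightarrow> real) \<Rightarrow> 'a \<Rightarrow> 'a"
  where "grad f x = (THE g. GDERIV f x :> g)"

lemma grad_eqI:
  assumes "GDERIV f x :> g"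
  shows "grad f x = g"
  unfolding grad_def
proof (rule the_equality[where P = "\<lambda>g. GDERIV f x :> g", OF assms])
  fix h assume "GDERIV f x :> h"
  with assms have "(\<lambda>v. v \<bullet> h) = (\<lambda>v. v \<bullet> g)"
    unfolding gderiv_def by (rule has_derivative_unique[rotated])
  then have "v \<bullet> h = v \<bullet> g" for v
    by (rule fun_cong)
  then show "h = g"
    by (metis inner_commute vector_eq_rdot)
qed

definition C1_scalar :: "('a::real_inner \<Rightarrow> real) \<Rightarrow> bool"
  where "C1_scalar f \<longleftrightarrow> (\<forall>x. GDERIV f x :> grad f x) \<and> continuous_on UNIV (grad f)"

definition velocity :: "(real \<Rightarrow> 'a::real_normed_vector) \<Rightarrow> real \<Rightarrow> 'a"
  where "velocity q t = vector_derivative q (at t)"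

definition C2_curve :: "(real \<Rightarrow> 'a::real_normed_vector) \<Rightarrow> bool"
  where "C2_curve q \<longleftrightarrow> q C1_differentiable_on UNIV \<and> velocity q C1_differentiable_on UNIV"

definition sublevel :: "('a \<Rightarrow> real) \<Rightarrow> real \<Rightarrow> 'a set"
  where "sublevel V c = {x. V x \<le> c}"

text \<open>The library distance of sets, \<^const>\<open>setdist\<close>, is the infimum of the pointwise distances
  for nonempty sets; by convention it is 0 if one of the sets is empty.\<close>

definition sublevel_splitting ::
    "('a::metric_space \<Rightarrow> real) \<Rightarrow> real \<Rightarrow> 'a set \<Rightarrow> 'a set \<Rightarrow> bool"
  where "sublevel_splitting V c Vm Vp \<longleftrightarrow>
    closed Vm \<and> closed Vp \<and> Vm \<noteq> {} \<and> Vp \<noteq> {} \<and>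
    sublevel V c = Vm \<union> Vp \<and> setdist Vm Vp > 0"

definition energy ::
    "('a::real_normed_vector \<Rightarrow> real) \<Rightarrow> (real \<Rightarrow> 'a) \<Rightarrow> real \<Rightarrow> real"
  where "energy V q t = (1/2) * (norm (velocity q t))\<^sup>2 - V (q t)"

definition core :: "('a::zero \<Rightarrow> real) \<Rightarrow> 'a set"
  where "core V = {x. V x > 0} \<union> {0}"

end

(*
  For every eps > 0, minimising the discretised Maupertuis product
  (sum |q_{i+1} - q_i|^2) * (sum W(q_i)), where W > 0 agrees with V - c away from the sublevel set,
  yields after refinement a trajectory of energy exactly -c from the eps-neighbourhood of Vm to that
  of Vp, with action bounded independently of eps.  Let sigma(eps) be the infimum of the actions of
  all such trajectories; it is bounded and increases as eps decreases.  A trajectory of nearly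
  minimal action cannot come close to Vp and then return to Vm: truncating it at the visit to Vp
  would save a fixed amount of action, contradicting the convergence of sigma.  Hence, within a
  bounded time of its last departure from Vm, it has been close to Vm and close to Vp.  At its
  endpoints the speed tends to 0 with eps, so reflecting it there in time gives curves on the whole
  line whose velocity jumps tend to 0, and by compactness they converge to the required solution.
  No minimiser in a function space is needed.
*)
theory Submission
  imports Defs "HOL-Complex_Analysis.Great_Picard"
begin

section \<open>Compactness for approximate solutions of differential equations\<close>

text \<open>The gradient is only continuous, and \<open>c\<close> may be a critical value: for
  \<open>c = 0\<close> the origin is a critical point at that level. So an initial value problem may
  have several solutions, and a trajectory of energy \<open>-c\<close> may need infinite time to
  reach the sublevel set. This is why every solution is obtained as a compactness limit, and why the
  variational problem is solved for a potential truncated near the sublevel set. The positive lower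
  bound of that potential is lost in the limit; the estimates that survive, on speed and action, use
  only upper bounds of \<open>V - c\<close>. The discretised product does not involve the time step.
  The step is read off the minimiser afterwards, and this choice fixes the energy. Reflection at the
  endpoints is possible because the equation is autonomous and reversible in time.\<close>

text \<open>A Peano-type compactness argument. The curves may be discontinuous: the additive error
  \<open>e\<close> allows for grid steps and jumps, provided it disappears as \<open>n\<close>
  grows. Since \<open>\<delta>\<close> is chosen before \<open>e\<close>, letting \<open>n\<close>
  tend to infinity leaves a genuine first-order expansion of the limit. Convergence is stated at
  moving times and along further subsequences, because the limit is later evaluated at times that
  depend on \<open>n\<close>.\<close>

lemma approx_solution_limit:
  fixes F :: "'a::euclidean_space \<Rightarrow> 'a" and y :: "nat \<Rightarrow> real \<Rightarrow> 'a" and I :: "real set"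
  assumes F: "continuous_on UNIV F"
    and bdd: "\<And>n t. t \<in> I \<Longrightarrow> norm (y n t) \<le> B"
    and approx: "\<And>\<eta>. \<eta> > 0 \<Longrightarrow> \<exists>\<delta>>0. \<forall>e>0. \<exists>N. \<forall>n\<ge>N. \<forall>s\<in>I. \<forall>t\<in>I. s \<le> t \<and> t - s < \<delta> \<longrightarrow>
      norm (y n t - y n s - (t - s) *\<^sub>R F (y n s)) \<le> \<eta> * (t - s) + e"
  obtains r z where "strict_mono (r :: nat \<Rightarrow> nat)"
    "\<And>l x s. strict_mono l \<Longrightarrow> (\<And>n. x n \<in> I) \<Longrightarrow> s \<in> I \<Longrightarrow> x \<longlonglongrightarrow> s \<Longrightarrow>
      (\<lambda>n. y (r (l n)) (x n)) \<longlonglongrightarrow> z s"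
    "\<And>t. t \<in> I \<Longrightarrow> (z has_vector_derivative F (z t)) (at t within I)"
proof -
  have "compact (F ` cball 0 B)"
    by (intro compact_continuous_image continuous_on_subset[OF F]) auto
  then obtain L0 where L0: "\<And>x. x \<in> cball 0 B \<Longrightarrow> norm (F x) \<le> L0"
    by (meson bounded_iff compact_imp_bounded imageI)
  \<comment> \<open>The extra 1 absorbs the error term of \<open>approx\<close> taken with
    \<open>\<eta> = 1\<close>.\<close>
  define L where "L = max L0 0 + 1"
  have FL: "norm (F (y n t)) \<le> L - 1" if "t \<in> I" for n t
    using L0[of "y n t"] bdd[OF that, of n] by (auto simp: L_def)
  have Lpos: "L > 0" by (simp add: L_def)
  obtain \<delta>0 where \<delta>0: "\<delta>0 > 0" and d0: "\<And>e. e > 0 \<Longrightarrow> \<exists>N. \<forall>n\<ge>N. \<forall>s\<in>I. \<forall>t\<in>I. s \<le> t \<and> t - s < \<delta>0 \<longrightarrow>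
      norm (y n t - y n s - (t - s) *\<^sub>R F (y n s)) \<le> 1 * (t - s) + e"
    using approx[of 1] by auto
  \<comment> \<open>Equicontinuity up to a vanishing error drives an Arzela-Ascoli argument: a
    diagonal subsequence on a countable dense set of times, then Cauchy sequences at all other
    times.\<close>
  have equi: "\<exists>N. \<forall>n\<ge>N. \<forall>s\<in>I. \<forall>t\<in>I. \<bar>t - s\<bar> < \<delta>0 \<longrightarrow> norm (y n t - y n s) \<le> L * \<bar>t - s\<bar> + e"
    if "e > 0" for e
  proof -
    obtain N where N: "\<And>n s t. n \<ge> N \<Longrightarrow> s \<in> I \<Longrightarrow> t \<in> I \<Longrightarrow> s \<le> t \<Longrightarrow> t - s < \<delta>0 \<Longrightarrow>
      norm (y n t - y n s - (t - s) *\<^sub>R F (y n s)) \<le> (t - s) + e"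
      using d0[OF \<open>e > 0\<close>] by auto
    have *: "norm (y n t - y n s) \<le> L * (t - s) + e"
      if "n \<ge> N" "s \<in> I" "t \<in> I" "s \<le> t" "t - s < \<delta>0" for n s t
    proof -
      have "norm (y n t - y n s) \<le> norm (y n t - y n s - (t - s) *\<^sub>R F (y n s)) + norm ((t - s) *\<^sub>R F (y n s))"
        by (metis diff_add_cancel norm_triangle_ineq)
      also have "norm ((t - s) *\<^sub>R F (y n s)) \<le> (t - s) * (L - 1)"
        using FL[of s n] that by (auto intro!: mult_left_mono)
      finally show ?thesis using N[OF that] by (simp add: algebra_simps)
    qed
    show ?thesis
    proof (intro exI[of _ N] allI impI ballI)
      fix n s t assume "N \<le> n" "s \<in> I" "t \<in> I" "\<bar>t - s\<bar> < \<delta>0"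
      then show "norm (y n t - y n s) \<le> L * \<bar>t - s\<bar> + e"
        using *[of n s t] *[of n t s] by (cases "s \<le> t") (auto simp: norm_minus_commute)
    qed
  qed
  obtain D where D: "countable D" "D \<subseteq> I" "I \<subseteq> closure D"
    using separable[of I] by auto
  obtain r where r: "strict_mono (r::nat\<Rightarrow>nat)" and conv: "\<And>x. x \<in> D \<Longrightarrow> \<exists>l. (\<lambda>n. y (r n) x) \<longlonglongrightarrow> l"
    using function_convergent_subsequence[of D y B] D bdd by blast
  have rn: "r n \<ge> n" for n using r by (simp add: seq_suble)
  have "\<exists>l. (\<lambda>n. y (r n) t) \<longlonglongrightarrow> l" if t: "t \<in> I" for t
  proof -
    have "Cauchy (\<lambda>n. y (r n) t)"
    proof (rule CauchyI)
      fix e :: real assume "e > 0"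
      define d where "d = min \<delta>0 (e / (8 * L))"
      have "d > 0" using \<open>e > 0\<close> Lpos \<delta>0 by (simp add: d_def)
      then obtain u where u: "u \<in> D" "dist u t < d"
        using D t by (meson closure_approachable subsetD)
      have Ld: "L * \<bar>u - t\<bar> \<le> e / 8"
      proof -
        have "\<bar>u - t\<bar> \<le> e / (8 * L)" using u by (simp add: d_def dist_real_def)
        then show ?thesis using Lpos by (simp add: field_simps)
      qed
      obtain N where N: "\<forall>n\<ge>N. \<forall>s\<in>I. \<forall>t\<in>I. \<bar>t - s\<bar> < \<delta>0 \<longrightarrow> norm (y n t - y n s) \<le> L * \<bar>t - s\<bar> + e/8"
        using equi[of "e/8"] \<open>e > 0\<close> by auto
      have n1: "norm (y (r n) t - y (r n) u) \<le> e/4" if "n \<ge> N" for n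
      proof -
        have "norm (y (r n) t - y (r n) u) \<le> L * \<bar>t - u\<bar> + e/8"
          using N[rule_format, of "r n" u t] rn[of n] that u D t by (auto simp: d_def dist_real_def abs_minus_commute)
        then show ?thesis using Ld by (simp add: abs_minus_commute)
      qed
      have "Cauchy (\<lambda>n. y (r n) u)" using conv[OF u(1)] LIMSEQ_imp_Cauchy by blast
      then obtain M where M: "\<And>m n. m \<ge> M \<Longrightarrow> n \<ge> M \<Longrightarrow> norm (y (r m) u - y (r n) u) < e/4"
        using CauchyD[of _ "e/4"] \<open>e > 0\<close> by (metis zero_less_divide_iff zero_less_numeral)
      show "\<exists>M. \<forall>m\<ge>M. \<forall>n\<ge>M. norm (y (r m) t - y (r n) t) < e"
      proof (intro exI[of _ "max M N"] allI impI)
        fix m n assume mn: "m \<ge> max M N" "n \<ge> max M N"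
        have eq: "y (r m) t - y (r n) t = (y (r m) t - y (r m) u) + (y (r m) u - y (r n) u) - (y (r n) t - y (r n) u)"
          by simp
        have "norm (y (r m) t - y (r n) t) \<le> norm (y (r m) t - y (r m) u) + norm (y (r m) u - y (r n) u) + norm (y (r n) t - y (r n) u)"
          unfolding eq by (intro order_trans[OF norm_triangle_ineq4] add_right_mono norm_triangle_ineq)
        then show "norm (y (r m) t - y (r n) t) < e"
          using n1[of m] n1[of n] M[of m n] mn \<open>e > 0\<close> by auto
      qed
    qed
    then show ?thesis by (simp add: Cauchy_convergent convergentD)
  qed
  then obtain z where z: "\<And>t. t \<in> I \<Longrightarrow> (\<lambda>n. y (r n) t) \<longlonglongrightarrow> z t" by metis
  have cc: "(\<lambda>n. y (r (l n)) (x n)) \<longlonglongrightarrow> z s"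
    if l: "strict_mono l" and x: "\<And>n. x n \<in> I" "s \<in> I" "x \<longlonglongrightarrow> s" for l x s
  proof -
    have "(\<lambda>n. y (r (l n)) (x n) - y (r (l n)) s) \<longlonglongrightarrow> 0"
    proof (rule LIMSEQ_I)
      fix e :: real assume "e > 0"
      define d where "d = min \<delta>0 (e / (4 * L))"
      have "d > 0" using \<open>e > 0\<close> Lpos \<delta>0 by (simp add: d_def)
      then obtain M where M: "\<And>n. n \<ge> M \<Longrightarrow> \<bar>x n - s\<bar> < d"
        using LIMSEQ_D[OF x(3)] by (metis real_norm_def)
      obtain N where N: "\<forall>n\<ge>N. \<forall>s\<in>I. \<forall>t\<in>I. \<bar>t - s\<bar> < \<delta>0 \<longrightarrow> norm (y n t - y n s) \<le> L * \<bar>t - s\<bar> + e/4"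
        using equi[of "e/4"] \<open>e > 0\<close> by auto
      show "\<exists>no. \<forall>n\<ge>no. norm (y (r (l n)) (x n) - y (r (l n)) s - 0) < e"
      proof (intro exI[of _ "max M N"] allI impI)
        fix n assume n: "n \<ge> max M N"
        have "norm (y (r (l n)) (x n) - y (r (l n)) s) \<le> L * \<bar>x n - s\<bar> + e/4"
          using N rn[of "l n"] seq_suble[OF l, of n] n x M[of n] by (auto simp: d_def)
        moreover have "L * \<bar>x n - s\<bar> \<le> e/4"
        proof -
          have "\<bar>x n - s\<bar> \<le> e / (4 * L)" using M[of n] n by (simp add: d_def)
          then show ?thesis using Lpos by (simp add: field_simps)
        qed
        ultimately show "norm (y (r (l n)) (x n) - y (r (l n)) s - 0) < e" using \<open>e > 0\<close> by auto
      qed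
    qed
    from tendsto_add[OF this LIMSEQ_subseq_LIMSEQ[OF z[OF x(2)] l, unfolded comp_def]] show ?thesis by simp
  qed
  have zlip: "norm (z t - z s) \<le> L * \<bar>t - s\<bar>" if "s \<in> I" "t \<in> I" "\<bar>t - s\<bar> < \<delta>0" for s t
  proof (rule field_le_epsilon)
    fix e :: real assume "e > 0"
    obtain N where N: "\<forall>n\<ge>N. \<forall>s\<in>I. \<forall>t\<in>I. \<bar>t - s\<bar> < \<delta>0 \<longrightarrow> norm (y n t - y n s) \<le> L * \<bar>t - s\<bar> + e"
      using equi[OF \<open>e > 0\<close>] by auto
    have "(\<lambda>n. norm (y (r n) t - y (r n) s)) \<longlonglongrightarrow> norm (z t - z s)"
      by (intro tendsto_intros z that)
    then show "norm (z t - z s) \<le> L * \<bar>t - s\<bar> + e"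
      by (rule LIMSEQ_le_const2) (use N rn that in \<open>meson order_trans\<close>)
  qed
  have zcont: "continuous_on I z"
    unfolding continuous_on_iff
  proof (intro ballI allI impI)
    fix s e :: real assume "s \<in> I" "e > 0"
    show "\<exists>d>0. \<forall>x'\<in>I. dist x' s < d \<longrightarrow> dist (z x') (z s) < e"
    proof (intro exI[of _ "min \<delta>0 (e / (2 * L))"] conjI ballI impI)
      fix t assume "t \<in> I" and t: "dist t s < min \<delta>0 (e / (2 * L))"
      then have "norm (z t - z s) \<le> L * \<bar>t - s\<bar>"
        using zlip \<open>s \<in> I\<close> by (auto simp: dist_real_def)
      also have "\<dots> \<le> e/2" using t Lpos by (simp add: dist_real_def field_simps)
      finally show "dist (z t) (z s) < e" using \<open>e > 0\<close> by (simp add: dist_norm)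
    qed (use \<delta>0 \<open>e > 0\<close> Lpos in auto)
  qed
  have Fz: "continuous_on I (\<lambda>t. F (z t))"
    by (rule continuous_on_compose2[OF F zcont]) auto
  have zapprox: "\<exists>\<delta>>0. \<forall>s\<in>I. \<forall>t\<in>I. s \<le> t \<and> t - s < \<delta> \<longrightarrow> norm (z t - z s - (t - s) *\<^sub>R F (z s)) \<le> \<eta> * (t - s)"
    if \<eta>: "\<eta> > 0" for \<eta>
  proof -
    obtain \<delta> where \<delta>: "\<delta> > 0" and d: "\<And>e. e > 0 \<Longrightarrow> \<exists>N. \<forall>n\<ge>N. \<forall>s\<in>I. \<forall>t\<in>I. s \<le> t \<and> t - s < \<delta> \<longrightarrow>
      norm (y n t - y n s - (t - s) *\<^sub>R F (y n s)) \<le> \<eta> * (t - s) + e"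
      using approx[OF \<eta>] by auto
    show ?thesis
    proof (intro exI[of _ \<delta>] conjI ballI impI \<delta>)
      fix s t assume st: "s \<in> I" "t \<in> I" "s \<le> t \<and> t - s < \<delta>"
      show "norm (z t - z s - (t - s) *\<^sub>R F (z s)) \<le> \<eta> * (t - s)"
      proof (rule field_le_epsilon)
        fix e :: real assume "e > 0"
        then obtain N where N: "\<forall>n\<ge>N. norm (y n t - y n s - (t - s) *\<^sub>R F (y n s)) \<le> \<eta> * (t - s) + e"
          using d[of e] st by meson
        have "(\<lambda>n. F (y (r n) s)) \<longlonglongrightarrow> F (z s)"
          by (rule continuous_on_tendsto_compose[OF F z]) (use st in auto)
        then have "(\<lambda>n. norm (y (r n) t - y (r n) s - (t - s) *\<^sub>R F (y (r n) s))) \<longlonglongrightarrow> norm (z t - z s - (t - s) *\<^sub>R F (z s))"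
          by (intro tendsto_intros z st) auto
        then show "norm (z t - z s - (t - s) *\<^sub>R F (z s)) \<le> \<eta> * (t - s) + e"
          by (rule LIMSEQ_le_const2) (use N rn in \<open>meson order_trans\<close>)
      qed
    qed
  qed
  have "(z has_vector_derivative F (z t)) (at t within I)" if t: "t \<in> I" for t
    unfolding has_vector_derivative_def has_derivative_within_alt
  proof (intro conjI allI impI)
    show "bounded_linear (\<lambda>x. x *\<^sub>R F (z t))" by (rule bounded_linear_scaleR_left)
    fix e :: real assume "e > 0"
    obtain d1 where d1: "d1 > 0" and D1: "\<And>s t. s\<in>I \<Longrightarrow> t\<in>I \<Longrightarrow> s \<le> t \<Longrightarrow> t - s < d1 \<Longrightarrow>
        norm (z t - z s - (t - s) *\<^sub>R F (z s)) \<le> e/2 * (t - s)"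
      using zapprox[of "e/2"] \<open>e > 0\<close> by auto
    obtain d2 where d2: "d2 > 0" and D2: "\<And>s. s \<in> I \<Longrightarrow> dist s t < d2 \<Longrightarrow> dist (F (z s)) (F (z t)) < e/2"
      using Fz t \<open>e > 0\<close> unfolding continuous_on_iff by (metis half_gt_zero)
    show "\<exists>d>0. \<forall>u\<in>I. norm (u - t) < d \<longrightarrow> norm (z u - z t - (u - t) *\<^sub>R F (z t)) \<le> e * norm (u - t)"
    proof (intro exI[of _ "min d1 d2"] conjI ballI impI)
      fix u assume u: "u \<in> I" "norm (u - t) < min d1 d2"
      show "norm (z u - z t - (u - t) *\<^sub>R F (z t)) \<le> e * norm (u - t)"
      proof (cases "t \<le> u")
        case True
        then show ?thesis using D1[of t u] u t \<open>e > 0\<close>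
          by (smt (verit) mult_right_mono real_norm_def field_sum_of_halves)
      next
        case False
        \<comment> \<open>The expansion is based at left endpoints only, so for \<open>u < t\<close>
          it is taken at \<open>u\<close>, and \<open>F (z u)\<close> is then replaced by
          \<open>F (z t)\<close>.\<close>
        have "z u - z t - (u - t) *\<^sub>R F (z t) = - (z t - z u - (t - u) *\<^sub>R F (z u)) + (t - u) *\<^sub>R (F (z t) - F (z u))"
          by (simp add: algebra_simps)
        then have "norm (z u - z t - (u - t) *\<^sub>R F (z t)) \<le> norm (z t - z u - (t - u) *\<^sub>R F (z u)) + norm ((t - u) *\<^sub>R (F (z t) - F (z u)))"
          by (metis norm_minus_cancel norm_triangle_ineq)
        also have "norm (z t - z u - (t - u) *\<^sub>R F (z u)) \<le> e/2 * (t - u)"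
          using D1[of u t] u t False by auto
        also have "norm ((t - u) *\<^sub>R (F (z t) - F (z u))) \<le> (t - u) * (e/2)"
          using D2[of u] u False by (auto simp: dist_norm norm_minus_commute intro!: mult_left_mono)
        finally show ?thesis using False by (simp add: algebra_simps)
      qed
    qed (use d1 d2 in auto)
  qed
  with r cc show thesis by (rule that)
qed

section \<open>Limits of one-step schemes\<close>

text \<open>Boundedness and consistency suffice: local errors of order \<open>o(1/m)\<close> add up
  to a small multiple of the elapsed time. The limits of the two end values are recorded because
  they will carry the boundary data.\<close>

lemma euler_scheme_limit:
  fixes F :: "'a::euclidean_space \<Rightarrow> 'a" and x :: "nat \<Rightarrow> nat \<Rightarrow> 'a" and m :: "nat \<Rightarrow> nat"
  assumes F: "continuous_on UNIV F"
    and m: "filterlim m at_top sequentially" and mpos: "\<And>n. m n > 0"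
    and bdd: "\<And>n i. i \<le> m n \<Longrightarrow> norm (x n i) \<le> B"
    and step: "\<And>\<eta>. \<eta> > 0 \<Longrightarrow> \<exists>N. \<forall>n\<ge>N. \<forall>i<m n.
      norm (x n (Suc i) - x n i - (1 / real (m n)) *\<^sub>R F (x n i)) \<le> \<eta> / real (m n)"
  obtains r z where "strict_mono (r :: nat \<Rightarrow> nat)"
    "\<And>t. t \<in> {0..1} \<Longrightarrow> (z has_vector_derivative F (z t)) (at t within {0..1})"
    "(\<lambda>n. x (r n) 0) \<longlonglongrightarrow> z 0" "(\<lambda>n. x (r n) (m (r n))) \<longlonglongrightarrow> z 1"
proof -
  \<comment> \<open>Step functions will do, as \<open>approx_solution_limit\<close> tolerates jumps.
    Rounding down yields exactly the last grid value at \<open>t = 1\<close>.\<close>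
  define y where "y n t = x n (nat \<lfloor>t * real (m n)\<rfloor>)" for n t
  have idx: "nat \<lfloor>t * real (m n)\<rfloor> \<le> m n" if "t \<in> {0..1}" for t n
  proof -
    have "t * real (m n) \<le> 1 * real (m n)" using that by (intro mult_right_mono) auto
    then show ?thesis by (simp add: nat_le_iff floor_le_iff)
  qed
  have "compact (F ` cball 0 B)"
    by (intro compact_continuous_image continuous_on_subset[OF F]) auto
  then obtain L0 where L0: "\<And>x. x \<in> cball 0 B \<Longrightarrow> norm (F x) \<le> L0"
    by (meson bounded_iff compact_imp_bounded imageI)
  define L where "L = max L0 0"
  have L: "L \<ge> 0" by (simp add: L_def)
  have FL: "norm (F x) \<le> L" if "norm x \<le> B" for x
    using L0[of x] that by (simp add: L_def)
  have approx: "\<exists>\<delta>>0. \<forall>e>0. \<exists>N. \<forall>n\<ge>N. \<forall>s\<in>{0..1}. \<forall>t\<in>{0..1}. s \<le> t \<and> t - s < \<delta> \<longrightarrow>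
      norm (y n t - y n s - (t - s) *\<^sub>R F (y n s)) \<le> \<eta> * (t - s) + e" if \<eta>: "\<eta> > 0" for \<eta>
  proof -
    have "uniformly_continuous_on (cball 0 B) F"
      by (intro compact_uniformly_continuous continuous_on_subset[OF F]) auto
    then obtain d where d: "d > 0" and D: "\<And>u v. norm u \<le> B \<Longrightarrow> norm v \<le> B \<Longrightarrow> dist v u < d \<Longrightarrow> dist (F v) (F u) < \<eta>/2"
      using \<eta> unfolding uniformly_continuous_on_def by (metis half_gt_zero mem_cball_0)
    \<comment> \<open>The speed of the scheme is eventually at most \<open>L + 1\<close>, so within
      time \<open>\<delta>\<close> it moves by less than \<open>d\<close> and \<open>F\<close>
      varies by less than \<open>\<eta>/2\<close>.\<close>
    define \<delta> where "\<delta> = d / (L + 1)"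
    have \<delta>: "\<delta> > 0" using d L by (simp add: \<delta>_def)
    show ?thesis
    proof (intro exI[of _ \<delta>] conjI allI impI \<delta>)
      fix e :: real assume e: "e > 0"
      \<comment> \<open>The bound by 1 yields the speed \<open>L + 1\<close>; the bound by
        \<open>\<eta>/2\<close> is half of the permitted error, the other half being the variation
        of \<open>F\<close>.\<close>
      obtain N1 where N1: "\<And>n i. n \<ge> N1 \<Longrightarrow> i < m n \<Longrightarrow>
          norm (x n (Suc i) - x n i - (1 / real (m n)) *\<^sub>R F (x n i)) \<le> min 1 (\<eta>/2) / real (m n)"
        using step[of "min 1 (\<eta>/2)"] \<eta> by auto
      \<comment> \<open>Rounding \<open>s\<close> and \<open>t\<close> to the grid costs at most
        \<open>(\<eta> + L) / M\<close>; this choice makes it at most \<open>e\<close>.\<close>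
      obtain N2 where N2: "\<And>n. n \<ge> N2 \<Longrightarrow> m n \<ge> nat \<lceil>(\<eta> + L) / e\<rceil>"
        using m unfolding filterlim_at_top eventually_sequentially by meson
      show "\<exists>N. \<forall>n\<ge>N. \<forall>s\<in>{0..1}. \<forall>t\<in>{0..1}. s \<le> t \<and> t - s < \<delta> \<longrightarrow>
          norm (y n t - y n s - (t - s) *\<^sub>R F (y n s)) \<le> \<eta> * (t - s) + e"
      proof (intro exI[of _ "max N1 N2"] allI ballI impI)
        fix n s t assume n: "n \<ge> max N1 N2" and s: "s \<in> {0..1::real}" and t: "t \<in> {0..1::real}"
          and st: "s \<le> t \<and> t - s < \<delta>"
        define M where "M = real (m n)"
        have M: "M > 0" using mpos[of n] by (simp add: M_def)
        have Me: "(\<eta> + L) / M \<le> e"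
        proof -
          have "(\<eta> + L) / e \<le> M" using N2[of n] n unfolding M_def by linarith
          then show ?thesis using e M by (simp add: field_simps)
        qed
        define i where "i = nat \<lfloor>s * M\<rfloor>"
        define j where "j = nat \<lfloor>t * M\<rfloor>"
        have im: "i \<le> m n" "j \<le> m n" using idx s t by (auto simp: i_def j_def M_def)
        have smtm: "s * M \<le> t * M" "0 \<le> s * M" "0 \<le> t * M" using st s t M by (auto intro: mult_right_mono)
        have ij: "i \<le> j" unfolding i_def j_def using smtm by (intro nat_mono floor_mono)
        have ib: "real i \<le> s * M" "s * M < real i + 1" "real j \<le> t * M" "t * M < real j + 1"
          using smtm unfolding i_def j_def by linarith+
        have st1: "norm (x n (Suc l) - x n l - (1 / M) *\<^sub>R F (x n l)) \<le> 1 / M"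
            "norm (x n (Suc l) - x n l - (1 / M) *\<^sub>R F (x n l)) \<le> (\<eta>/2) / M" if "l < m n" for l
        proof -
          have a: "norm (x n (Suc l) - x n l - (1 / M) *\<^sub>R F (x n l)) \<le> min 1 (\<eta>/2) / M"
            using N1[of n l] n that by (simp add: M_def)
          have b: "min 1 (\<eta>/2) / M \<le> 1 / M" "min 1 (\<eta>/2) / M \<le> (\<eta>/2) / M" using M by (intro divide_right_mono; simp)+
          show "norm (x n (Suc l) - x n l - (1 / M) *\<^sub>R F (x n l)) \<le> 1 / M"
            "norm (x n (Suc l) - x n l - (1 / M) *\<^sub>R F (x n l)) \<le> (\<eta>/2) / M" using a b by linarith+
        qed
        have lip: "norm (x n (i + k) - x n i) \<le> (L + 1) * (real k / M)" if "i + k \<le> m n" for k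
          using that
        proof (induction k)
          case (Suc k)
          have eq: "x n (i + Suc k) - x n i = (x n (i + k) - x n i) + (x n (Suc (i + k)) - x n (i + k) - (1 / M) *\<^sub>R F (x n (i + k))) + (1 / M) *\<^sub>R F (x n (i + k))"
            by simp
          have "norm (x n (i + Suc k) - x n i) \<le> norm (x n (i + k) - x n i) + norm (x n (Suc (i + k)) - x n (i + k) - (1 / M) *\<^sub>R F (x n (i + k))) + norm ((1 / M) *\<^sub>R F (x n (i + k)))"
            unfolding eq by (intro norm_triangle_mono order_refl)
          also have "\<dots> \<le> (L + 1) * (real k / M) + 1 / M + (1 / M) * L"
            using Suc st1(1)[of "i + k"] FL[OF bdd[of "i+k" n]] M
            by (intro add_mono) (auto simp: divide_right_mono)
          also have "\<dots> = (L + 1) * (real (Suc k) / M)" using M by (simp add: field_simps)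
          finally show ?case .
        qed simp
        have tay: "norm (x n (i + k) - x n i - (real k / M) *\<^sub>R F (x n i)) \<le> \<eta> * (real k / M)" if "i + k \<le> j" for k
          using that
        proof (induction k)
          case (Suc k)
          have k: "i + k < m n" using Suc.prems im by simp
          have "real k \<le> (t - s) * M" using ib Suc.prems ij by (simp add: algebra_simps)
          then have "real k / M \<le> t - s" using M by (simp add: field_simps)
          then have "real k / M < \<delta>" using st by simp
          then have "(L + 1) * (real k / M) < d" using L by (simp add: \<delta>_def field_simps)
          then have "dist (x n (i + k)) (x n i) < d" using lip[of k] k by (simp add: dist_norm)
          then have FF: "norm (F (x n (i + k)) - F (x n i)) < \<eta>/2"
            using D[of "x n i" "x n (i+k)"] bdd[of "i+k" n] bdd[of i n] k by (simp add: dist_norm)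
          have eq: "x n (i + Suc k) - x n i - (real (Suc k) / M) *\<^sub>R F (x n i) =
             (x n (i + k) - x n i - (real k / M) *\<^sub>R F (x n i)) + (x n (Suc (i + k)) - x n (i + k) - (1 / M) *\<^sub>R F (x n (i + k)))
             + (1 / M) *\<^sub>R (F (x n (i + k)) - F (x n i))"
            by (simp add: algebra_simps add_divide_distrib)
          have "norm (x n (i + Suc k) - x n i - (real (Suc k) / M) *\<^sub>R F (x n i)) \<le>
             norm (x n (i + k) - x n i - (real k / M) *\<^sub>R F (x n i)) + norm (x n (Suc (i + k)) - x n (i + k) - (1 / M) *\<^sub>R F (x n (i + k)))
             + norm ((1 / M) *\<^sub>R (F (x n (i + k)) - F (x n i)))"
            unfolding eq by (intro norm_triangle_mono order_refl)
          also have "norm ((1 / M) *\<^sub>R (F (x n (i + k)) - F (x n i))) = (1/M) * norm (F (x n (i + k)) - F (x n i))"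
            using M by simp
          also have "norm (x n (i + k) - x n i - (real k / M) *\<^sub>R F (x n i)) + norm (x n (Suc (i + k)) - x n (i + k) - (1 / M) *\<^sub>R F (x n (i + k)))
             + (1/M) * norm (F (x n (i + k)) - F (x n i)) \<le> \<eta> * (real k / M) + (\<eta>/2)/M + (1/M) * (\<eta>/2)"
            using Suc st1(2)[OF k] FF M by (intro add_mono mult_left_mono) auto
          also have "\<dots> = \<eta> * (real (Suc k) / M)" using M by (simp add: field_simps)
          finally show ?case .
        qed simp
        define \<kappa> where "\<kappa> = real (j - i) / M"
        have k1: "\<bar>(t - s) - \<kappa>\<bar> \<le> 1 / M"
        proof -
          have "\<bar>(t - s) * M - real (j - i)\<bar> \<le> 1" using ib ij by (simp add: algebra_simps of_nat_diff)
          then have "\<bar>(t - s) * M - real (j - i)\<bar> / M \<le> 1 / M" using M by (simp add: divide_right_mono)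
          moreover have "\<bar>(t - s) * M - real (j - i)\<bar> / M = \<bar>((t - s) * M - real (j - i)) / M\<bar>" using M by simp
          moreover have "((t - s) * M - real (j - i)) / M = (t - s) - \<kappa>" using M by (simp add: \<kappa>_def field_simps)
          ultimately show ?thesis by simp
        qed
        have yx: "y n t = x n j" "y n s = x n i" by (simp_all add: y_def i_def j_def M_def)
        have "y n t - y n s - (t - s) *\<^sub>R F (y n s) = (x n j - x n i - \<kappa> *\<^sub>R F (x n i)) + (\<kappa> - (t - s)) *\<^sub>R F (x n i)"
          by (simp add: yx algebra_simps)
        then have "norm (y n t - y n s - (t - s) *\<^sub>R F (y n s)) \<le> norm (x n j - x n i - \<kappa> *\<^sub>R F (x n i)) + norm ((\<kappa> - (t - s)) *\<^sub>R F (x n i))"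
          by (metis norm_triangle_ineq)
        also have "\<dots> \<le> \<eta> * \<kappa> + (1 / M) * L"
        proof (intro add_mono)
          show "norm (x n j - x n i - \<kappa> *\<^sub>R F (x n i)) \<le> \<eta> * \<kappa>" using tay[of "j - i"] ij by (simp add: \<kappa>_def)
          have "norm ((\<kappa> - (t - s)) *\<^sub>R F (x n i)) = \<bar>(t - s) - \<kappa>\<bar> * norm (F (x n i))" by (simp add: abs_minus_commute)
          also have "\<dots> \<le> (1 / M) * L" using k1 FL[OF bdd[OF im(1)]] M by (intro mult_mono) auto
          finally show "norm ((\<kappa> - (t - s)) *\<^sub>R F (x n i)) \<le> (1 / M) * L" .
        qed
        also have "\<dots> \<le> \<eta> * ((t - s) + 1 / M) + (1 / M) * L"
          using k1 \<eta> M by (intro add_mono mult_left_mono) auto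
        also have "\<dots> = \<eta> * (t - s) + (\<eta> + L) / M" by (simp add: algebra_simps add_divide_distrib)
        also have "\<dots> \<le> \<eta> * (t - s) + e" using Me by simp
        finally show "norm (y n t - y n s - (t - s) *\<^sub>R F (y n s)) \<le> \<eta> * (t - s) + e" .
      qed
    qed
  qed
  have bd: "\<And>n t. t \<in> {0..1} \<Longrightarrow> norm (y n t) \<le> B" unfolding y_def by (intro bdd idx)
  show thesis
  proof (rule approx_solution_limit[OF F bd approx])
    fix r :: "nat \<Rightarrow> nat" and z
    assume r: "strict_mono r" and lim: "\<And>l x s. strict_mono l \<Longrightarrow> (\<And>n. x n \<in> {0..1}) \<Longrightarrow> s \<in> {0..1} \<Longrightarrow> x \<longlonglongrightarrow> s \<Longrightarrow>
        (\<lambda>n. y (r (l n)) (x n)) \<longlonglongrightarrow> z s"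
      and z: "\<And>t. t \<in> {0..1} \<Longrightarrow> (z has_vector_derivative F (z t)) (at t within {0..1})"
    have id: "strict_mono (\<lambda>n::nat. n)" by (simp add: strict_mono_def)
    show thesis
    proof (rule that[OF r z])
      show "(\<lambda>n. x (r n) 0) \<longlonglongrightarrow> z 0" using lim[OF id, of "\<lambda>_. 0" 0] by (simp add: y_def)
      show "(\<lambda>n. x (r n) (m (r n))) \<longlonglongrightarrow> z 1" using lim[OF id, of "\<lambda>_. 1" 1] by (simp add: y_def)
    qed
  qed
qed

section \<open>Limits of piecewise solutions on the whole line\<close>

lemma has_vector_derivative_lipschitz:
  fixes f :: "real \<Rightarrow> 'a::real_normed_vector"
  assumes "convex S" "\<And>x. x \<in> S \<Longrightarrow> (f has_vector_derivative f' x) (at x within S)"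
    and "\<And>x. x \<in> S \<Longrightarrow> norm (f' x) \<le> L" "x \<in> S" "y \<in> S"
  shows "norm (f y - f x) \<le> L * norm (y - x)"
proof (rule differentiable_bound[of S f "\<lambda>x h. h *\<^sub>R f' x"])
  fix u assume u: "u \<in> S"
  show "onorm (\<lambda>h. h *\<^sub>R f' u) \<le> L"
  proof (rule onorm_le)
    fix h :: real
    have "\<bar>h\<bar> * norm (f' u) \<le> \<bar>h\<bar> * L" by (intro mult_left_mono assms(3) u) simp
    then show "norm (h *\<^sub>R f' u) \<le> L * norm h" by (simp add: mult.commute)
  qed
qed (use assms in \<open>auto simp: has_vector_derivative_def\<close>)

lemma floor_cell:
  fixes T :: real
  assumes "T > 0"
  shows "t \<in> {a + real_of_int \<lfloor>(t - a) / T\<rfloor> * T..a + (real_of_int \<lfloor>(t - a) / T\<rfloor> + 1) * T}"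
proof -
  define k where "k = \<lfloor>(t - a) / T\<rfloor>"
  have "real_of_int k \<le> (t - a) / T" "(t - a) / T < real_of_int k + 1"
    unfolding k_def by linarith+
  then have "t \<in> {a + real_of_int k * T..a + (real_of_int k + 1) * T}"
    using assms by (auto simp: pos_le_divide_eq pos_divide_less_eq algebra_simps)
  then show ?thesis by (simp add: k_def)
qed

text \<open>The lower bound \<open>\<tau>\<close> on the cell lengths keeps the jumps from
  accumulating: a short time interval meets at most one cell boundary, hence one small jump. Neither
  the lengths \<open>T n\<close> nor the offsets \<open>a n\<close> have to converge.\<close>

lemma piecewise_solution_limit:
  fixes F :: "'a::euclidean_space \<Rightarrow> 'a" and Y :: "nat \<Rightarrow> int \<Rightarrow> real \<Rightarrow> 'a"
    and T a :: "nat \<Rightarrow> real"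
  assumes F: "continuous_on UNIV F" and \<tau>: "\<tau> > 0" "\<And>n. \<tau> \<le> T n"
    and Y: "\<And>n k t. t \<in> {a n + k * T n..a n + (k + 1) * T n} \<Longrightarrow>
       (Y n k has_vector_derivative F (Y n k t)) (at t within {a n + k * T n..a n + (k + 1) * T n})"
    and B: "\<And>n k t. t \<in> {a n + k * T n..a n + (k + 1) * T n} \<Longrightarrow> norm (Y n k t) \<le> B"
    and jump: "\<And>e. e > 0 \<Longrightarrow> \<exists>N. \<forall>n\<ge>N. \<forall>k.
       norm (Y n (k + 1) (a n + (k + 1) * T n) - Y n k (a n + (k + 1) * T n)) \<le> e"
  defines "y \<equiv> \<lambda>n t. Y n \<lfloor>(t - a n) / T n\<rfloor> t"
  obtains r z where "strict_mono (r :: nat \<Rightarrow> nat)"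
    "\<And>l x s. strict_mono l \<Longrightarrow> x \<longlonglongrightarrow> s \<Longrightarrow> (\<lambda>n. y (r (l n)) (x n)) \<longlonglongrightarrow> z s"
    "\<And>t. (z has_vector_derivative F (z t)) (at t)"
proof -
  define J where "J n k = {a n + k * T n..a n + (real_of_int k + 1) * T n}" for n and k :: int
  have T: "T n > 0" for n using \<tau> by (smt (verit))
  have fl: "t \<in> J n \<lfloor>(t - a n) / T n\<rfloor>" for n t
    unfolding J_def by (rule floor_cell[OF T])
  have "compact (F ` cball 0 B)"
    by (intro compact_continuous_image continuous_on_subset[OF F]) auto
  then obtain L0 where L0: "\<And>x. x \<in> cball 0 B \<Longrightarrow> norm (F x) \<le> L0"
    by (meson bounded_iff compact_imp_bounded imageI)
  define L where "L = max L0 0"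
  have L: "L \<ge> 0" by (simp add: L_def)
  have FL: "norm (F x) \<le> L" if "norm x \<le> B" for x
    using L0[of x] that by (simp add: L_def)
  have lip: "norm (Y n k t - Y n k s) \<le> L * norm (t - s)" if "s \<in> J n k" "t \<in> J n k" for n k s t
  proof (rule has_vector_derivative_lipschitz[of "J n k" "Y n k" "\<lambda>t. F (Y n k t)"])
    show "convex (J n k)" by (simp add: J_def)
  qed (use that Y B FL in \<open>auto simp: J_def\<close>)
  have approx: "\<exists>\<delta>>0. \<forall>e>0. \<exists>N. \<forall>n\<ge>N. \<forall>s\<in>UNIV. \<forall>t\<in>UNIV. s \<le> t \<and> t - s < \<delta> \<longrightarrow>
      norm (y n t - y n s - (t - s) *\<^sub>R F (y n s)) \<le> \<eta> * (t - s) + e" if \<eta>: "\<eta> > 0" for \<eta>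
  proof -
    have "uniformly_continuous_on (cball 0 B) F"
      by (intro compact_uniformly_continuous continuous_on_subset[OF F]) auto
    then obtain d where d: "d > 0" and D: "\<And>u v. norm u \<le> B \<Longrightarrow> norm v \<le> B \<Longrightarrow> dist v u < d \<Longrightarrow> dist (F v) (F u) < \<eta>/2"
      using \<eta> unfolding uniformly_continuous_on_def by (metis half_gt_zero mem_cball_0)
    \<comment> \<open>The bound \<open>\<tau>\<close> admits at most one cell boundary between
      \<open>s\<close> and \<open>t\<close>; half of \<open>d\<close> is reserved for the motion
      along the pieces, the other half for the jump.\<close>
    define \<delta> where "\<delta> = min \<tau> (d / (2 * (L + 1)))"
    have \<delta>: "\<delta> > 0" using d L \<tau> by (simp add: \<delta>_def)
    have L\<delta>: "L * u < d / 2" if "0 \<le> u" "u < \<delta>" for u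
    proof -
      have "u < d / (2 * (L + 1))" using that by (simp add: \<delta>_def)
      then have "(L + 1) * u < d / 2" using L by (simp add: field_simps)
      then show ?thesis using that by (simp add: algebra_simps)
    qed
    have branch: "norm (Y n k t - Y n k s - (t - s) *\<^sub>R F (Y n k s)) \<le> (\<eta>/2) * (t - s)"
      if st: "s \<in> J n k" "t \<in> J n k" "s \<le> t" "t - s < \<delta>" for n k s t
    proof -
      have sub: "{s..t} \<subseteq> J n k" using st by (auto simp: J_def)
      have "norm (Y n k t - Y n k s - (t - s) *\<^sub>R F (Y n k s)) \<le> norm (t - s) * (\<eta>/2)"
      proof (rule vector_differentiable_bound_linearization[of "{s..t}"])
        fix u assume u: "u \<in> {s..t}"
        then have uJ: "u \<in> J n k" using sub by auto
        show "(Y n k has_vector_derivative F (Y n k u)) (at u within {s..t})"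
          by (rule has_vector_derivative_within_subset[OF Y[of u n k] sub[unfolded J_def]]) (use uJ in \<open>auto simp: J_def\<close>)
        have "dist (Y n k u) (Y n k s) \<le> L * norm (u - s)" using lip[OF st(1) uJ] by (simp add: dist_norm)
        also have "\<dots> < d" using L\<delta>[of "u - s"] u st d by auto
        finally show "norm (F (Y n k u) - F (Y n k s)) \<le> \<eta>/2"
          using D[of "Y n k s" "Y n k u"] B[of s n k] B[of u n k] uJ st(1) by (auto simp: J_def dist_norm)
      qed (use st in \<open>auto simp: closed_segment_eq_real_ivl\<close>)
      then show ?thesis using st by (simp add: mult.commute)
    qed
    show ?thesis
    proof (intro exI[of _ \<delta>] conjI allI impI \<delta>)
      fix e :: real assume e: "e > 0"
      obtain N where N: "\<And>n k. n \<ge> N \<Longrightarrow>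
          norm (Y n (k + 1) (a n + (k + 1) * T n) - Y n k (a n + (k + 1) * T n)) \<le> min e (d/2)"
        using jump[of "min e (d/2)"] e d by auto
      show "\<exists>N. \<forall>n\<ge>N. \<forall>s\<in>UNIV. \<forall>t\<in>UNIV. s \<le> t \<and> t - s < \<delta> \<longrightarrow>
          norm (y n t - y n s - (t - s) *\<^sub>R F (y n s)) \<le> \<eta> * (t - s) + e"
      proof (intro exI[of _ N] allI ballI impI)
        fix n s t assume n: "N \<le> n" and st: "s \<le> t \<and> t - s < \<delta>"
        define k where "k = \<lfloor>(s - a n) / T n\<rfloor>"
        define k' where "k' = \<lfloor>(t - a n) / T n\<rfloor>"
        have s: "s \<in> J n k" and t: "t \<in> J n k'" using fl by (simp_all add: k_def k'_def)
        have ys: "y n s = Y n k s" and yt: "y n t = Y n k' t" by (simp_all add: y_def k_def k'_def)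
        have "k \<le> k'" unfolding k_def k'_def using st T[of n] by (intro floor_mono divide_right_mono) auto
        have "(t - a n) / T n < (s - a n) / T n + 1"
          using st \<tau>(2)[of n] T[of n] by (simp add: \<delta>_def field_simps)
        then have "k' \<le> k + 1" unfolding k_def k'_def by linarith
        show "norm (y n t - y n s - (t - s) *\<^sub>R F (y n s)) \<le> \<eta> * (t - s) + e"
        proof (cases "k' = k")
          case True
          have "norm (y n t - y n s - (t - s) *\<^sub>R F (y n s)) \<le> (\<eta>/2) * (t - s)"
            using branch[of s n k t] s t st True by (simp add: ys yt)
          also have "\<dots> \<le> \<eta> * (t - s) + e" using \<eta> st e by (smt (verit) mult_right_mono field_sum_of_halves)
          finally show ?thesis .
        next
          case False
          then have k': "k' = k + 1" using \<open>k \<le> k'\<close> \<open>k' \<le> k + 1\<close> by linarith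
          \<comment> \<open>Split at the common boundary of the two cells. The value just after the
            jump is \<open>u\<close>; expanding there, one still has to pay for replacing
            \<open>F u\<close> by the field at time \<open>s\<close>.\<close>
          define p where "p = a n + (k + 1) * T n"
          have p: "p \<in> J n k" "p \<in> J n (k + 1)" "s \<le> p" "p \<le> t"
            using T[of n] s t by (auto simp: p_def J_def k' algebra_simps)
          define u where "u = Y n (k + 1) p"
          have jp: "norm (u - Y n k p) \<le> min e (d/2)" using N[OF n, of k] by (simp add: p_def u_def)
          have "dist u (Y n k s) \<le> norm (u - Y n k p) + norm (Y n k p - Y n k s)"
            unfolding dist_norm using norm_triangle_ineq[of "u - Y n k p" "Y n k p - Y n k s"] by simp
          also have "\<dots> < d/2 + d/2"
            using jp lip[OF s p(1)] L\<delta>[of "p - s"] p st by auto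
          finally have "dist u (Y n k s) < d" by simp
          then have FF: "norm (F u - F (Y n k s)) \<le> \<eta>/2"
            using D[of "Y n k s" u] B[of s n k] B[of p n "k+1"] s p by (auto simp: J_def dist_norm u_def)
          have b1: "norm (Y n k' t - u - (t - p) *\<^sub>R F u) \<le> (\<eta>/2) * (t - p)"
            unfolding u_def k' by (rule branch) (use p st t in \<open>auto simp: k'\<close>)
          have b2: "norm (Y n k p - Y n k s - (p - s) *\<^sub>R F (Y n k s)) \<le> (\<eta>/2) * (p - s)"
            by (rule branch) (use p st s in auto)
          have "y n t - y n s - (t - s) *\<^sub>R F (y n s) = (Y n k' t - u - (t - p) *\<^sub>R F u)
              + (Y n k p - Y n k s - (p - s) *\<^sub>R F (Y n k s)) + (u - Y n k p) + (t - p) *\<^sub>R (F u - F (Y n k s))"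
            by (simp add: ys yt algebra_simps)
          also have "norm \<dots> \<le> (\<eta>/2) * (t - p) + (\<eta>/2) * (p - s) + e + (t - p) * (\<eta>/2)"
          proof (intro norm_triangle_mono b1 b2)
            show "norm (u - Y n k p) \<le> e" using jp by simp
            show "norm ((t - p) *\<^sub>R (F u - F (Y n k s))) \<le> (t - p) * (\<eta>/2)"
              unfolding norm_scaleR using p by (intro mult_mono FF) auto
          qed
          also have "\<dots> \<le> \<eta> * (t - s) + e"
          proof -
            have "(\<eta>/2) * (p - s) \<ge> 0" using \<eta> p by simp
            moreover have "(\<eta>/2) * (t - p) + (\<eta>/2) * (p - s) + e + (t - p) * (\<eta>/2) = \<eta> * (t - s) + e - (\<eta>/2) * (p - s)"
              by (simp add: field_simps)
            ultimately show ?thesis by linarith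
          qed
          finally show ?thesis .
        qed
      qed
    qed
  qed
  have "norm (y n t) \<le> B" for n t using B fl unfolding y_def J_def by blast
  then have bd: "\<And>n t. t \<in> UNIV \<Longrightarrow> norm (y n t) \<le> B" by simp
  show thesis
  proof (rule approx_solution_limit[OF F bd approx])
    fix r :: "nat \<Rightarrow> nat" and z
    assume r: "strict_mono r" and lim: "\<And>l x s. strict_mono l \<Longrightarrow> (\<And>n. x n \<in> UNIV) \<Longrightarrow> s \<in> UNIV \<Longrightarrow> x \<longlonglongrightarrow> s \<Longrightarrow>
        (\<lambda>n. y (r (l n)) (x n)) \<longlonglongrightarrow> z s"
      and z: "\<And>t. t \<in> UNIV \<Longrightarrow> (z has_vector_derivative F (z t)) (at t within UNIV)"
    show thesis
    proof (rule that[of r z])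
      show "(\<lambda>n. y (r (l n)) (x n)) \<longlonglongrightarrow> z s" if "strict_mono l" "x \<longlonglongrightarrow> s" for l x s
        using lim[OF that(1) _ _ that(2)] by simp
      show "(z has_vector_derivative F (z t)) (at t)" for t using z[of t] by simp
    qed (rule r)
  qed
qed

section \<open>Connecting two points in a positive potential\<close>

text \<open>Comparison with equidistant points on the segment bounds the minimal product by
  \<open>C * (norm (b - a))\<^sup>2\<close>. Dividing by the lower bound \<open>n * \<mu>\<close> of
  the potential sum bounds \<open>n\<close> times the sum of squares, and Cauchy-Schwarz then
  confines every vertex to a fixed ball. Hence the minimiser is interior in each free vertex, and
  the Euler-Lagrange equation holds there.\<close>

lemma discrete_maupertuis_minimizer:
  fixes W :: "'a::euclidean_space \<Rightarrow> real" and g :: "'a \<Rightarrow> 'a" and a b :: 'a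
  assumes W: "\<And>x. GDERIV W x :> g x" and low: "\<And>x. \<mu> \<le> W x" and up: "\<And>x. W x \<le> C"
    and \<mu>: "\<mu> > 0" and n: "n > 0"
  obtains q :: "nat \<Rightarrow> 'a" where "q 0 = a" "q n = b"
    "(\<Sum>i<n. (norm (q (Suc i) - q i))\<^sup>2) * (\<Sum>i<n. W (q i)) \<le> C * (norm (b - a))\<^sup>2"
    "\<And>i. i \<le> n \<Longrightarrow> (norm (q i - a))\<^sup>2 \<le> C * (norm (b - a))\<^sup>2 / \<mu>"
    "\<And>i. Suc i < n \<Longrightarrow> (2 * (\<Sum>i<n. W (q i))) *\<^sub>R (q (Suc (Suc i)) - 2 *\<^sub>R q (Suc i) + q i)
       = (\<Sum>i<n. (norm (q (Suc i) - q i))\<^sup>2) *\<^sub>R g (q (Suc i))"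
proof -
  define S where "S q = (\<Sum>i<n. (norm (q (Suc i) - q i))\<^sup>2)" for q :: "nat \<Rightarrow> 'a"
  define P where "P q = (\<Sum>i<n. W (q i))" for q :: "nat \<Rightarrow> 'a"
  have C: "\<mu> \<le> C" using low[of 0] up[of 0] by simp
  define R where "R = sqrt (C * (norm (b - a))\<^sup>2 / \<mu>)"
  have R2: "R\<^sup>2 = C * (norm (b - a))\<^sup>2 / \<mu>" using C \<mu> by (simp add: R_def)
  have R0: "R \<ge> 0" using C \<mu> by (simp add: R_def)
  have Rab: "norm (b - a) \<le> R"
  proof -
    have "1 * (norm (b - a))\<^sup>2 \<le> (C / \<mu>) * (norm (b - a))\<^sup>2" using C \<mu> by (intro mult_right_mono) (auto simp: field_simps)
    then show ?thesis unfolding R_def by (intro real_le_rsqrt) simp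
  qed
  \<comment> \<open>Enlarging the a priori radius \<open>R\<close> by 1 leaves a unit ball for the
    variation of each free vertex. Indices beyond \<open>n\<close> also get a compact factor, so
    that Tychonoff's theorem applies to the space of all sequences.\<close>
  define Q where "Q i = (if i = 0 then {a} else if i = n then {b} else cball a (R + 1))" for i
  define X where "X = PiE UNIV Q"
  have "compact X"
  proof -
    have "compactin (product_topology (\<lambda>_. euclidean) UNIV) X"
      unfolding X_def compactin_PiE by (auto simp: Q_def)
    then show ?thesis by (simp add: euclidean_product_topology)
  qed
  have Xiff: "u \<in> X \<longleftrightarrow> (\<forall>i. u i \<in> Q i)" for u
    by (simp add: X_def PiE_UNIV_domain Pi_iff)
  define p where "p i = (if i \<le> n then a + (real i / real n) *\<^sub>R (b - a) else a)" for i
  have pX: "p \<in> X"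
  proof -
    have "norm ((real i / real n) *\<^sub>R (b - a)) \<le> R" if "i \<le> n" for i
    proof -
      have "norm ((real i / real n) *\<^sub>R (b - a)) = (real i / real n) * norm (b - a)"
        by (subst norm_scaleR) simp
      also have "\<dots> \<le> 1 * norm (b - a)"
        using that n by (intro mult_right_mono) auto
      finally show ?thesis using Rab by simp
    qed
    then show ?thesis using n R0 by (auto simp: X_def Q_def p_def dist_norm)
      (smt (verit))
  qed
  have Wc: "continuous_on UNIV W"
    using W unfolding gderiv_def by (meson continuous_at_imp_continuous_on has_derivative_continuous)
  have coord: "continuous_on X (\<lambda>q. q i)" for i
    by (rule continuous_on_subset[OF continuous_on_product_coordinates]) simp
  have "continuous_on X (\<lambda>q. S q * P q)"
    unfolding S_def P_def
    by (intro continuous_intros continuous_on_compose2[OF Wc] coord) auto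
  then obtain q where qX: "q \<in> X" and qmin: "\<And>u. u \<in> X \<Longrightarrow> S q * P q \<le> S u * P u"
    using continuous_attains_inf[OF \<open>compact X\<close>, of "\<lambda>q. S q * P q"] pX by blast
  have q0: "q 0 = a" and qn: "q n = b" using qX n by (auto simp: X_def Q_def PiE_def Pi_def) (metis singletonD less_irrefl)+
  have Plow: "real n * \<mu> \<le> P u" and Pup: "P u \<le> real n * C" for u
    using sum_mono[of "{..<n}" "\<lambda>_. \<mu>" "\<lambda>i. W (u i)"] sum_mono[of "{..<n}" "\<lambda>i. W (u i)" "\<lambda>_. C"] low up by (auto simp: P_def)
  have Sp: "S p = (norm (b - a))\<^sup>2 / real n"
  proof -
    have "(norm (p (Suc i) - p i))\<^sup>2 = (norm (b - a) / real n)\<^sup>2" if "i < n" for i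
    proof -
      have "p (Suc i) - p i = (1 / real n) *\<^sub>R (b - a)"
        using that by (simp add: p_def add_divide_distrib scaleR_left.add)
      then show ?thesis by simp
    qed
    then have "S p = real n * (norm (b - a) / real n)\<^sup>2" by (simp add: S_def)
    then show ?thesis using n by (simp add: power2_eq_square)
  qed
  have J: "S q * P q \<le> C * (norm (b - a))\<^sup>2"
  proof -
    have "S q * P q \<le> S p * P p" by (rule qmin[OF pX])
    also have "\<dots> \<le> (norm (b - a))\<^sup>2 / real n * (real n * C)" unfolding Sp by (intro mult_left_mono Pup) auto
    also have "\<dots> = C * (norm (b - a))\<^sup>2" using n by simp
    finally show ?thesis .
  qed
  have S0: "S q \<ge> 0" by (simp add: S_def sum_nonneg)
  have nS: "real n * S q \<le> R\<^sup>2"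
  proof -
    have "S q * (real n * \<mu>) \<le> S q * P q" by (intro mult_left_mono Plow S0)
    then have "S q * (real n * \<mu>) \<le> C * (norm (b - a))\<^sup>2" using J by linarith
    then show ?thesis unfolding R2 using \<mu> by (simp add: field_simps)
  qed
  have dist2: "(norm (q i - a))\<^sup>2 \<le> R\<^sup>2" if "i \<le> n" for i
  proof -
    have "q i - a = (\<Sum>l<i. q (Suc l) - q l)" by (simp add: sum_lessThan_telescope q0)
    then have "norm (q i - a) \<le> (\<Sum>l<i. norm (q (Suc l) - q l))" by (simp add: norm_sum)
    also have "\<dots> \<le> (\<Sum>l<n. norm (q (Suc l) - q l))" using that by (intro sum_mono2) auto
    finally have "(norm (q i - a))\<^sup>2 \<le> (\<Sum>l<n. norm (q (Suc l) - q l))\<^sup>2" by (intro power_mono) auto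
    also have "\<dots> \<le> S q * real n"
      using sum_squared_le_sum_of_squares[of "\<lambda>l. norm (q (Suc l) - q l)" "{..<n}"] by (simp add: S_def)
    also have "\<dots> \<le> R\<^sup>2" using nS by (simp add: mult.commute)
    finally show ?thesis .
  qed
  have EL: "(2 * P q) *\<^sub>R (q (Suc (Suc j)) - 2 *\<^sub>R q (Suc j) + q j) = S q *\<^sub>R g (q (Suc j))" if j: "Suc j < n" for j
  proof -
    \<comment> \<open>\<open>A\<close> and \<open>D\<close> collect the terms without the vertex
      \<open>Suc j\<close>, so that \<open>f\<close> is the product as a function of this vertex
      alone. Since \<open>Suc j < n\<close>, it occurs in exactly two squares and one potential
      term.\<close>
    define A where "A = (\<Sum>l\<in>{..<n}-{j,Suc j}. (norm (q (Suc l) - q l))\<^sup>2)"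
    define D where "D = (\<Sum>l\<in>{..<n}-{Suc j}. W (q l))"
    define f where "f x = (A + (x - q j) \<bullet> (x - q j) + (x - q (Suc (Suc j))) \<bullet> (x - q (Suc (Suc j)))) * (D + W x)" for x
    have Sx: "S (q(Suc j := x)) = A + (x - q j) \<bullet> (x - q j) + (x - q (Suc (Suc j))) \<bullet> (x - q (Suc (Suc j)))" for x
    proof -
      have "{..<n} = ({..<n}-{j,Suc j}) \<union> {j, Suc j}" using j by auto
      then have "S (q(Suc j := x)) = (\<Sum>l\<in>({..<n}-{j,Suc j}) \<union> {j, Suc j}. (norm ((q(Suc j := x)) (Suc l) - (q(Suc j := x)) l))\<^sup>2)"
        unfolding S_def by simp
      also have "\<dots> = (\<Sum>l\<in>{..<n}-{j,Suc j}. (norm ((q(Suc j := x)) (Suc l) - (q(Suc j := x)) l))\<^sup>2)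
         + (\<Sum>l\<in>{j,Suc j}. (norm ((q(Suc j := x)) (Suc l) - (q(Suc j := x)) l))\<^sup>2)"
        by (intro sum.union_disjoint) auto
      also have "(\<Sum>l\<in>{..<n}-{j,Suc j}. (norm ((q(Suc j := x)) (Suc l) - (q(Suc j := x)) l))\<^sup>2) = A"
        unfolding A_def by (intro sum.cong) auto
      also have "(\<Sum>l\<in>{j,Suc j}. (norm ((q(Suc j := x)) (Suc l) - (q(Suc j := x)) l))\<^sup>2)
          = (x - q j) \<bullet> (x - q j) + (x - q (Suc (Suc j))) \<bullet> (x - q (Suc (Suc j)))"
        by (simp add: power2_norm_eq_inner inner_diff_left inner_diff_right inner_commute)
      finally show ?thesis by (simp only: add.assoc)
    qed
    have Px: "P (q(Suc j := x)) = D + W x" for x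
    proof -
      have "P (q(Suc j := x)) = W x + (\<Sum>l\<in>{..<n}-{Suc j}. W ((q(Suc j := x)) l))"
        unfolding P_def using j by (subst sum.remove[of _ "Suc j"]) auto
      also have "(\<Sum>l\<in>{..<n}-{Suc j}. W ((q(Suc j := x)) l)) = D" unfolding D_def by (intro sum.cong) auto
      finally show ?thesis by (simp only: add.commute)
    qed
    have fx: "f x = S (q(Suc j := x)) * P (q(Suc j := x))" for x by (simp add: f_def Sx Px)
    define x0 where "x0 = q (Suc j)"
    have Sq: "S q = A + (x0 - q j) \<bullet> (x0 - q j) + (x0 - q (Suc (Suc j))) \<bullet> (x0 - q (Suc (Suc j)))"
      and Pq: "P q = D + W x0" using Sx[of x0] Px[of x0] by (simp_all add: x0_def)
    have dW: "(W has_derivative (\<lambda>h. h \<bullet> g x0)) (at x0)" using W by (simp add: gderiv_def)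
    have df: "(f has_derivative (\<lambda>h. S q * (h \<bullet> g x0) + (2 * (h \<bullet> (x0 - q j)) + 2 * (h \<bullet> (x0 - q (Suc (Suc j))))) * P q)) (at x0)"
      unfolding f_def Sq Pq
      by (auto intro!: derivative_eq_intros dW simp: fun_eq_iff algebra_simps inner_commute)
    have "x0 \<in> cball a R" using dist2[of "Suc j"] j R0
      by (simp add: x0_def dist_norm norm_minus_commute power2_le_iff_abs_le)
    then have ball: "ball x0 1 \<subseteq> cball a (R + 1)"
      by (auto simp: dist_norm) (smt (verit) norm_triangle_ineq norm_minus_commute diff_add_cancel add_diff_eq)
    have min: "f x0 \<le> f x" if "x \<in> ball x0 1" for x
    proof -
      have "x \<in> Q (Suc j)" using j ball that by (auto simp: Q_def)
      then have "q(Suc j := x) \<in> X" using qX by (simp add: Xiff)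
      then show ?thesis using qmin[of "q(Suc j := x)"] fx[of x] Sq Pq by (simp only: f_def)
    qed
    have "(\<lambda>h. S q * (h \<bullet> g x0) + (2 * (h \<bullet> (x0 - q j)) + 2 * (h \<bullet> (x0 - q (Suc (Suc j))))) * P q) = (\<lambda>h. 0)"
      by (rule differential_zero_maxmin[OF _ _ df, of "ball x0 1"]) (use min in auto)
    then have "h \<bullet> (S q *\<^sub>R g x0 - (2 * P q) *\<^sub>R (q (Suc (Suc j)) - 2 *\<^sub>R x0 + q j)) = 0" for h
      by (simp add: fun_eq_iff algebra_simps)
    then have "S q *\<^sub>R g x0 - (2 * P q) *\<^sub>R (q (Suc (Suc j)) - 2 *\<^sub>R x0 + q j) = 0"
      by (metis inner_eq_zero_iff)
    then show ?thesis by (simp add: x0_def)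
  qed
  show thesis
    by (rule that[of q]) (use q0 qn J dist2 EL in \<open>auto simp: R2 S_def P_def\<close>)
qed

section \<open>Limit of the discrete minimisers\<close>

text \<open>The bound on \<open>w T - w 0\<close> is free of \<open>\<mu>\<close>, which makes the
  action uniform when the truncation level tends to 0. It arises as the limit of
  \<open>h n * Pn n\<close>, the square root of \<open>Sn n * Pn n / 2\<close>, and that product is
  bounded in terms of \<open>C\<close> and the two points.\<close>

lemma positive_potential_connection:
  fixes W :: "'a::euclidean_space \<Rightarrow> real" and g :: "'a \<Rightarrow> 'a" and a b :: 'a
  assumes W: "\<And>x. GDERIV W x :> g x" and g: "continuous_on UNIV g"
    and low: "\<And>x. \<mu> \<le> W x" and up: "\<And>x. W x \<le> C" and \<mu>: "\<mu> > 0" and ab: "a \<noteq> b"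
  obtains T q v w where "T > 0" "q 0 = a" "q T = b" "w T - w 0 \<le> norm (b - a) * sqrt (C / 2)"
    "\<And>t. t \<in> {0..T} \<Longrightarrow> (q has_vector_derivative v t) (at t within {0..T})"
    "\<And>t. t \<in> {0..T} \<Longrightarrow> (v has_vector_derivative g (q t)) (at t within {0..T})"
    "\<And>t. t \<in> {0..T} \<Longrightarrow> (w has_vector_derivative W (q t)) (at t within {0..T})"
    "\<And>t. t \<in> {0..T} \<Longrightarrow> (norm (v t))\<^sup>2 / 2 = W (q t)"
proof -
  have C: "\<mu> \<le> C" using low[of 0] up[of 0] by simp
  define R where "R = C * (norm (b - a))\<^sup>2 / \<mu>"
  have R: "R > 0" using C \<mu> ab by (simp add: R_def)
  define S where "S n q = (\<Sum>i<Suc n. (norm (q (Suc i) - q i))\<^sup>2)" for n and q :: "nat \<Rightarrow> 'a"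
  define P where "P n q = (\<Sum>i<Suc n. W (q i))" for n and q :: "nat \<Rightarrow> 'a"
  have "\<exists>q. q 0 = a \<and> q (Suc n) = b \<and> S n q * P n q \<le> C * (norm (b - a))\<^sup>2 \<and>
    (\<forall>i\<le>Suc n. (norm (q i - a))\<^sup>2 \<le> R) \<and>
    (\<forall>i<n. (2 * P n q) *\<^sub>R (q (Suc (Suc i)) - 2 *\<^sub>R q (Suc i) + q i) = S n q *\<^sub>R g (q (Suc i)))" for n
  proof (rule discrete_maupertuis_minimizer[OF W low up \<mu>, of "Suc n" a b])
    fix q :: "nat \<Rightarrow> 'a" assume q: "q 0 = a" "q (Suc n) = b"
      "(\<Sum>i<Suc n. (norm (q (Suc i) - q i))\<^sup>2) * (\<Sum>i<Suc n. W (q i)) \<le> C * (norm (b - a))\<^sup>2"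
      "\<And>i. i \<le> Suc n \<Longrightarrow> (norm (q i - a))\<^sup>2 \<le> C * (norm (b - a))\<^sup>2 / \<mu>"
      "\<And>i. Suc i < Suc n \<Longrightarrow> (2 * (\<Sum>i<Suc n. W (q i))) *\<^sub>R (q (Suc (Suc i)) - 2 *\<^sub>R q (Suc i) + q i)
       = (\<Sum>i<Suc n. (norm (q (Suc i) - q i))\<^sup>2) *\<^sub>R g (q (Suc i))"
    show ?thesis
      unfolding S_def P_def R_def by (intro exI[of _ q] conjI allI impI q Suc_mono)
  qed simp
  then obtain q where q0: "\<And>n. q n 0 = a" and q1: "\<And>n. q n (Suc n) = b"
    and J: "\<And>n. S n (q n) * P n (q n) \<le> C * (norm (b - a))\<^sup>2"
    and qR: "\<And>n i. i \<le> Suc n \<Longrightarrow> (norm (q n i - a))\<^sup>2 \<le> R"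
    and EL: "\<And>n i. i < n \<Longrightarrow> (2 * P n (q n)) *\<^sub>R (q n (Suc (Suc i)) - 2 *\<^sub>R q n (Suc i) + q n i) = S n (q n) *\<^sub>R g (q n (Suc i))"
    by metis
  define Sn where "Sn n = S n (q n)" for n
  define Pn where "Pn n = P n (q n)" for n
  have Plow: "real (Suc n) * \<mu> \<le> Pn n" and Pup: "Pn n \<le> real (Suc n) * C" for n
    using sum_mono[of "{..<Suc n}" "\<lambda>_. \<mu>" "\<lambda>i. W (q n i)"] sum_mono[of "{..<Suc n}" "\<lambda>i. W (q n i)" "\<lambda>_. C"] low up
    unfolding Pn_def P_def by (simp_all del: sum.lessThan_Suc)
  have P0: "Pn n > 0" for n using Plow[of n] \<mu> by (smt (verit) mult_pos_pos of_nat_0_less_iff zero_less_Suc)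
  have Slow: "(norm (b - a))\<^sup>2 \<le> real (Suc n) * Sn n" for n
  proof -
    have "b - a = (\<Sum>l<Suc n. q n (Suc l) - q n l)" by (simp only: sum_lessThan_telescope q0 q1)
    then have "norm (b - a) \<le> (\<Sum>l<Suc n. norm (q n (Suc l) - q n l))" by (simp only: norm_sum)
    then have "(norm (b - a))\<^sup>2 \<le> (\<Sum>l<Suc n. norm (q n (Suc l) - q n l))\<^sup>2" by (intro power_mono) auto
    also have "\<dots> \<le> Sn n * real (Suc n)"
      using sum_squared_le_sum_of_squares[of "\<lambda>l. norm (q n (Suc l) - q n l)" "{..<Suc n}"]
      unfolding Sn_def S_def by (simp only: card_lessThan)
    finally show ?thesis by (simp add: mult.commute)
  qed
  have S0: "Sn n > 0" for n
  proof -
    have "0 < real (Suc n) * Sn n" using Slow[of n] ab by (smt (verit) zero_less_norm_iff zero_less_power2 right_minus_eq norm_eq_zero)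
    then show ?thesis by (simp add: zero_less_mult_iff)
  qed
  have Sup: "real (Suc n) * Sn n \<le> R" for n
  proof -
    have "Sn n * (real (Suc n) * \<mu>) \<le> Sn n * Pn n" using S0[of n] by (intro mult_left_mono Plow) auto
    also have "\<dots> \<le> C * (norm (b - a))\<^sup>2" using J by (simp add: Sn_def Pn_def)
    finally show ?thesis using \<mu> by (simp add: R_def field_simps)
  qed
  \<comment> \<open>with this time step the Euler--Lagrange equation becomes a leapfrog scheme for \<open>q'' = g q\<close>
    whose mean kinetic energy equals its mean potential\<close>
  define h where "h n = sqrt (Sn n / (2 * Pn n))" for n
  have h0: "h n > 0" for n using S0 P0 by (simp add: h_def)
  have h2: "(h n)\<^sup>2 * (2 * Pn n) = Sn n" for n
    using S0[of n] P0[of n] by (simp add: h_def)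
  define T where "T n = real (Suc n) * h n" for n
  \<comment> \<open>The bounds are read off from \<open>TT\<close>: the first factor of
    \<open>(T n)\<^sup>2\<close> lies between \<open>(norm (b - a))\<^sup>2\<close> and
    \<open>R\<close>, the second between \<open>1 / (2 * C)\<close> and
    \<open>1 / (2 * \<mu>)\<close>.\<close>
  define T1 where "T1 = sqrt ((norm (b - a))\<^sup>2 / (2 * C))"
  define T2 where "T2 = sqrt (R / (2 * \<mu>))"
  have T1: "T1 > 0" and T2: "T2 > 0" using ab C \<mu> R by (simp_all add: T1_def T2_def)
  have TT: "(T n)\<^sup>2 = (real (Suc n) * Sn n) * (real (Suc n) / (2 * Pn n))" for n
    using h2[of n] P0[of n] unfolding T_def by (simp add: power_mult_distrib field_simps power2_eq_square)
  have Tlow: "T1 \<le> T n" for n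
  proof -
    have "1 / (2 * C) \<le> real (Suc n) / (2 * Pn n)" using Pup[of n] P0[of n] C \<mu> by (simp add: field_simps)
    then have "(norm (b - a))\<^sup>2 * (1 / (2 * C)) \<le> (T n)\<^sup>2" unfolding TT
      using Slow[of n] less_imp_le[OF S0[of n]] C \<mu> by (intro mult_mono) auto
    then show ?thesis unfolding T1_def by (intro real_le_lsqrt) (auto simp: T_def h0 less_imp_le)
  qed
  have Tup: "T n \<le> T2" for n
  proof -
    have "real (Suc n) / (2 * Pn n) \<le> 1 / (2 * \<mu>)" using Plow[of n] P0[of n] \<mu> by (simp add: field_simps)
    then have "(T n)\<^sup>2 \<le> R * (1 / (2 * \<mu>))" unfolding TT
      using Sup[of n] R P0[of n] by (intro mult_mono) (auto simp: less_imp_le)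
    then show ?thesis unfolding T2_def by (intro real_le_rsqrt) auto
  qed
  have T0: "T n > 0" for n using Tlow[of n] T1 by simp
  have "bounded (g ` cball a (sqrt R))"
    by (intro compact_imp_bounded compact_continuous_image continuous_on_subset[OF g]) auto
  then obtain G0 where "\<And>x. x \<in> cball a (sqrt R) \<Longrightarrow> norm (g x) \<le> G0"
    unfolding bounded_iff by blast
  then obtain G where G: "\<And>x. x \<in> cball a (sqrt R) \<Longrightarrow> norm (g x) \<le> G" and G0: "G \<ge> 0"
    by (metis max.cobounded1 max.cobounded2 order_trans)
  have qcb: "q n i \<in> cball a (sqrt R)" if "i \<le> Suc n" for n i
    using real_le_rsqrt[OF qR[OF that]] by (simp add: dist_norm norm_minus_commute)
  \<comment> \<open>The velocity at index \<open>Suc n\<close> is not a difference quotient: it is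
    defined so that the velocity step \<open>vg\<close> also holds at \<open>i = n\<close>.\<close>
  define v where "v n i = (if i \<le> n then (1 / h n) *\<^sub>R (q n (Suc i) - q n i)
      else (1 / h n) *\<^sub>R (q n (Suc n) - q n n) + h n *\<^sub>R g (q n (Suc n)))" for n i
  have qv: "q n (Suc i) - q n i = h n *\<^sub>R v n i" if "i \<le> n" for n i
    using that h0[of n] by (simp add: v_def)
  have vg: "v n (Suc i) - v n i = h n *\<^sub>R g (q n (Suc i))" if i: "i \<le> n" for n i
  proof (cases "i = n")
    case False
    then have "i < n" using i by simp
    have "(2 * Pn n) *\<^sub>R (q n (Suc (Suc i)) - 2 *\<^sub>R q n (Suc i) + q n i) = (2 * Pn n) *\<^sub>R ((h n)\<^sup>2 *\<^sub>R g (q n (Suc i)))"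
      using EL[OF \<open>i < n\<close>] h2[of n] by (simp add: Sn_def Pn_def mult.commute)
    then have "q n (Suc (Suc i)) - 2 *\<^sub>R q n (Suc i) + q n i = (h n)\<^sup>2 *\<^sub>R g (q n (Suc i))"
      using P0[of n] by (metis scaleR_cancel_left less_irrefl mult_eq_0_iff zero_neq_numeral)
    moreover have "v n (Suc i) - v n i = (1 / h n) *\<^sub>R (q n (Suc (Suc i)) - 2 *\<^sub>R q n (Suc i) + q n i)"
      using \<open>i < n\<close> by (simp add: v_def algebra_simps scaleR_2)
    ultimately show ?thesis using h0[of n] by (simp add: power2_eq_square)
  qed (simp add: v_def)
  have Sv: "(\<Sum>i<Suc n. (norm (v n i))\<^sup>2) = 2 * Pn n" for n
  proof -
    have "Sn n = (\<Sum>i<Suc n. (h n)\<^sup>2 * (norm (v n i))\<^sup>2)"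
      unfolding Sn_def S_def by (intro sum.cong) (auto simp: qv power_mult_distrib)
    also have "\<dots> = (h n)\<^sup>2 * (\<Sum>i<Suc n. (norm (v n i))\<^sup>2)" by (simp only: sum_distrib_left)
    finally show ?thesis using h2[of n] h0[of n]
      by (metis less_irrefl mult_cancel_left power_eq_0_iff)
  qed
  have vdiff: "norm (v n (i + k) - v n i) \<le> real k * (h n * G)" if "i + k \<le> Suc n" for n i k
    using that
  proof (induction k)
    case (Suc k)
    have "norm (v n (i + Suc k) - v n i) \<le> norm (v n (Suc (i + k)) - v n (i + k)) + norm (v n (i + k) - v n i)"
      using norm_triangle_ineq[of "v n (Suc (i + k)) - v n (i + k)" "v n (i + k) - v n i"] by simp
    also have "norm (v n (Suc (i + k)) - v n (i + k)) \<le> h n * G"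
      using Suc.prems G[OF qcb[of "Suc (i+k)" n]] h0[of n] by (subst vg) (auto intro: mult_left_mono)
    finally show ?case using Suc by (simp add: algebra_simps)
  qed simp
  define K where "K = sqrt (2 * C) + T2 * G"
  have K0: "K \<ge> 0" using C \<mu> T2 G0 by (simp add: K_def)
  \<comment> \<open>By \<open>Sv\<close> the mean squared velocity is at most \<open>2 * C\<close>,
    so one of the velocities is at most \<open>sqrt (2 * C)\<close>; over the bounded total time the
    others differ from it by at most \<open>T2 * G\<close>.\<close>
  have vK: "norm (v n j) \<le> K" if j: "j \<le> Suc n" for n j
  proof -
    have "\<exists>i<Suc n. (norm (v n i))\<^sup>2 \<le> 2 * C"
    proof (rule ccontr)
      assume "\<not> ?thesis"
      then have "(\<Sum>i<Suc n. 2 * C) < (\<Sum>i<Suc n. (norm (v n i))\<^sup>2)"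
        by (intro sum_strict_mono) (auto simp: not_le)
      then show False using Sv[of n] Pup[of n] by (simp add: algebra_simps)
    qed
    then obtain i where i: "i < Suc n" "(norm (v n i))\<^sup>2 \<le> 2 * C" by blast
    have vi: "norm (v n i) \<le> sqrt (2 * C)" using i by (intro real_le_rsqrt)
    have "norm (v n j - v n i) \<le> real (Suc n) * (h n * G)"
    proof (cases "i \<le> j")
      case True
      have "norm (v n (i + (j - i)) - v n i) \<le> real (j - i) * (h n * G)" using True j by (intro vdiff) auto
      also have "\<dots> \<le> real (Suc n) * (h n * G)" using j h0[of n] G0 by (intro mult_right_mono) auto
      finally show ?thesis using True by simp
    next
      case False
      have "norm (v n (j + (i - j)) - v n j) \<le> real (i - j) * (h n * G)" using False i by (intro vdiff) auto
      also have "\<dots> \<le> real (Suc n) * (h n * G)" using i h0[of n] G0 by (intro mult_right_mono) auto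
      finally show ?thesis using False by (simp add: norm_minus_commute)
    qed
    also have "\<dots> = T n * G" by (simp add: T_def)
    also have "\<dots> \<le> T2 * G" using Tup G0 by (intro mult_right_mono)
    finally show ?thesis using vi norm_triangle_sub[of "v n j" "v n i"] by (simp add: K_def)
  qed
  \<comment> \<open>The durations depend on \<open>n\<close>. Along a subsequence they converge, and
    rescaling time to the unit interval turns their limit into a factor of the vector field.\<close>
  obtain k Ti where k: "strict_mono (k :: nat \<Rightarrow> nat)" and Tk: "(\<lambda>n. T (k n)) \<longlonglongrightarrow> Ti" and TI: "Ti \<in> {T1..T2}"
    using compact_Icc[of T1 T2, unfolded compact_def, rule_format, of T] Tlow Tup by (auto simp: comp_def)
  have Ti0: "Ti > 0" using TI T1 by auto
  \<comment> \<open>the third and fourth components accumulate the potential and the kinetic energy; that they agree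
    at the final time forces the conserved energy to vanish\<close>
  define F where "F y = Ti *\<^sub>R (fst (snd y), g (fst y), W (fst y), (norm (fst (snd y)))\<^sup>2 / 2)" for y :: "'a \<times> 'a \<times> real \<times> real"
  define x where "x n i = (q (k n) i, v (k n) i, h (k n) * (\<Sum>l<i. W (q (k n) l)), h (k n) * (\<Sum>l<i. (norm (v (k n) l))\<^sup>2 / 2))" for n i
  have Wc: "continuous_on UNIV W"
    using W unfolding gderiv_def by (meson continuous_at_imp_continuous_on has_derivative_continuous)
  have Fc: "continuous_on UNIV F" unfolding F_def
    by (intro continuous_intros continuous_on_compose2[OF g] continuous_on_compose2[OF Wc]) auto
  have kn: "n \<le> k n" for n using k by (simp add: seq_suble)
  have m: "filterlim (\<lambda>n. Suc (k n)) at_top sequentially"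
    using filterlim_subseq[OF k] by (rule filterlim_compose[OF filterlim_Suc])
  have xbd: "norm (x n i) \<le> (norm a + sqrt R) + K + T2 * C + T2 * (K\<^sup>2 / 2)" if i: "i \<le> Suc (k n)" for n i
  proof -
    have n1: "norm (q (k n) i) \<le> norm a + sqrt R"
      using qcb[OF i] norm_triangle_sub[of "q (k n) i" a] by (simp add: dist_norm norm_minus_commute)
    have sb: "norm (h (k n) * (\<Sum>l<i. f l)) \<le> T2 * D" if f: "\<And>l. l < i \<Longrightarrow> 0 \<le> f l" "\<And>l. l < i \<Longrightarrow> f l \<le> D" "D \<ge> 0" for f and D :: real
    proof -
      have "(\<Sum>l<i. f l) \<le> real i * D" using sum_mono[of "{..<i}" f "\<lambda>_. D"] f by auto
      also have "\<dots> \<le> real (Suc (k n)) * D" using i f(3) by (intro mult_right_mono) auto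
      finally have "h (k n) * (\<Sum>l<i. f l) \<le> h (k n) * (real (Suc (k n)) * D)" using h0[of "k n"] by (intro mult_left_mono) auto
      also have "\<dots> = T (k n) * D" by (simp add: T_def)
      also have "\<dots> \<le> T2 * D" using Tup f(3) by (intro mult_right_mono)
      finally have "h (k n) * (\<Sum>l<i. f l) \<le> T2 * D" .
      moreover have "0 \<le> (\<Sum>l<i. f l)" by (intro sum_nonneg) (use f in auto)
      ultimately show ?thesis using h0[of "k n"] by (simp add: abs_mult)
    qed
    have n3: "norm (h (k n) * (\<Sum>l<i. W (q (k n) l))) \<le> T2 * C"
      using up low \<mu> C by (intro sb) (auto intro: order_trans[OF less_imp_le[OF \<mu>]])
    have n4: "norm (h (k n) * (\<Sum>l<i. (norm (v (k n) l))\<^sup>2 / 2)) \<le> T2 * (K\<^sup>2 / 2)"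
      using vK i K0 by (intro sb) (auto intro!: power_mono)
    show ?thesis unfolding x_def
      using norm_Pair_le[of "q (k n) i" "snd (x n i)"] norm_Pair_le[of "v (k n) i" "snd (snd (x n i))"]
        norm_Pair_le[of "fst (snd (snd (x n i)))" "snd (snd (snd (x n i)))"] n1 n3 n4 vK[OF i]
      unfolding x_def fst_conv snd_conv by linarith
  qed
  have step: "\<exists>N. \<forall>n\<ge>N. \<forall>i<Suc (k n).
      norm (x n (Suc i) - x n i - (1 / real (Suc (k n))) *\<^sub>R F (x n i)) \<le> \<eta> / real (Suc (k n))" if \<eta>: "\<eta> > 0" for \<eta>
  proof -
    have "uniformly_continuous_on (cball a (sqrt R)) g"
      by (intro compact_uniformly_continuous continuous_on_subset[OF g]) auto
    moreover have "\<eta> / (2 * Ti) > 0" using \<eta> Ti0 by simp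
    ultimately obtain d where d: "d > 0" and D: "\<And>u u'. u \<in> cball a (sqrt R) \<Longrightarrow> u' \<in> cball a (sqrt R) \<Longrightarrow> dist u' u < d \<Longrightarrow> dist (g u') (g u) < \<eta> / (2 * Ti)"
      unfolding uniformly_continuous_on_def by meson
    define M where "M = K + G + C + K\<^sup>2 / 2"
    have M: "M > 0" using K0 G0 C \<mu> by (simp add: M_def add_nonneg_pos add_pos_nonneg)
    obtain N1 where N1: "\<And>n. n \<ge> N1 \<Longrightarrow> \<bar>T (k n) - Ti\<bar> < \<eta> / (2 * M)"
      using LIMSEQ_D[OF Tk, of "\<eta> / (2 * M)"] \<eta> M by auto
    obtain N2 where N2: "\<And>n. n \<ge> N2 \<Longrightarrow> Suc (k n) \<ge> Suc (nat \<lceil>T2 * K / d\<rceil>)"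
      using m unfolding filterlim_at_top eventually_sequentially by meson
    show ?thesis
    proof (intro exI[of _ "max N1 N2"] allI impI)
      fix n i assume n: "n \<ge> max N1 N2" and i: "i < Suc (k n)"
      define \<nu> where "\<nu> = real (Suc (k n))"
      have \<nu>: "\<nu> > 0" by (simp add: \<nu>_def)
      have hT: "h (k n) = (1/\<nu>) * T (k n)" unfolding T_def \<nu>_def by simp
      have "dist (q (k n) (Suc i)) (q (k n) i) < d"
      proof -
        have "dist (q (k n) (Suc i)) (q (k n) i) = h (k n) * norm (v (k n) i)"
          using i qv[of i "k n"] h0[of "k n"] by (simp add: dist_norm)
        also have "\<dots> \<le> (T2 / \<nu>) * K"
          using hT Tup[of "k n"] \<nu> vK[of i "k n"] i h0[of "k n"] T2 by (intro mult_mono) (auto simp: divide_right_mono)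
        also have "\<dots> < d"
        proof -
          have "T2 * K / d < \<nu>" using N2[of n] n unfolding \<nu>_def by linarith
          then show ?thesis using d \<nu> by (simp add: field_simps)
        qed
        finally show ?thesis .
      qed
      then have gd: "norm (g (q (k n) (Suc i)) - g (q (k n) i)) \<le> \<eta> / (2 * Ti)"
        using D[OF qcb[of i "k n"] qcb[of "Suc i" "k n"]] i by (simp add: dist_norm)
      define Y where "Y = (v (k n) i, g (q (k n) (Suc i)), W (q (k n) i), (norm (v (k n) i))\<^sup>2 / 2)"
      \<comment> \<open>The scheme evaluates \<open>g\<close> at the new position, an Euler step
        would do so at the old one. \<open>Z\<close> is the difference, small by uniform continuity
        since a single step is short; it takes one half of \<open>\<eta>\<close>, the error in the
        duration the other.\<close>
      define Z where "Z = (0::'a, g (q (k n) (Suc i)) - g (q (k n) i), 0::real, 0::real)"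
      have "x n (Suc i) - x n i = h (k n) *\<^sub>R Y"
        using qv[of i "k n"] vg[of i "k n"] i by (simp add: x_def Y_def algebra_simps)
      then have e1: "x n (Suc i) - x n i = (1/\<nu>) *\<^sub>R (T (k n) *\<^sub>R Y)" by (simp add: hT)
      have e2: "F (x n i) = Ti *\<^sub>R (Y - Z)" by (simp add: F_def x_def Y_def Z_def)
      have "T (k n) *\<^sub>R Y - Ti *\<^sub>R (Y - Z) = (T (k n) - Ti) *\<^sub>R Y + Ti *\<^sub>R Z"
        by (simp add: scaleR_diff_left scaleR_diff_right)
      then have eq: "x n (Suc i) - x n i - (1/\<nu>) *\<^sub>R F (x n i) = (1/\<nu>) *\<^sub>R ((T (k n) - Ti) *\<^sub>R Y + Ti *\<^sub>R Z)"
        unfolding e1 e2 by (metis scaleR_diff_right)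
      have nY: "norm Y \<le> M"
      proof -
        have "norm Y \<le> norm (v (k n) i) + (norm (g (q (k n) (Suc i))) + (norm (W (q (k n) i)) + norm ((norm (v (k n) i))\<^sup>2 / 2)))"
          unfolding Y_def by (meson add_left_mono norm_Pair_le order_trans)
        also have "\<dots> \<le> K + (G + (C + K\<^sup>2 / 2))"
        proof -
          have "norm (W (q (k n) i)) \<le> C" using up[of "q (k n) i"] low[of "q (k n) i"] \<mu> by simp
          moreover have "norm (g (q (k n) (Suc i))) \<le> G" using G qcb[of "Suc i" "k n"] i by auto
          moreover have "norm (v (k n) i) \<le> K" using vK[of i "k n"] i by simp
          moreover from this have "(norm (v (k n) i))\<^sup>2 \<le> K\<^sup>2" by (intro power_mono) auto
          ultimately show ?thesis by simp
        qed
        finally show ?thesis by (simp add: M_def)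
      qed
      have nZ: "norm Z \<le> \<eta> / (2 * Ti)" using gd by (simp add: Z_def norm_Pair)
      have "norm ((T (k n) - Ti) *\<^sub>R Y + Ti *\<^sub>R Z) \<le> \<bar>T (k n) - Ti\<bar> * norm Y + Ti * norm Z"
        using norm_triangle_ineq[of "(T (k n) - Ti) *\<^sub>R Y" "Ti *\<^sub>R Z"] Ti0 by simp
      also have "\<dots> \<le> \<eta> / (2 * M) * M + Ti * (\<eta> / (2 * Ti))"
        using N1[of n] n nY nZ Ti0 M \<eta> by (intro add_mono mult_mono) auto
      also have "\<dots> = \<eta>" using M Ti0 by simp
      finally have "(1/\<nu>) * norm ((T (k n) - Ti) *\<^sub>R Y + Ti *\<^sub>R Z) \<le> (1/\<nu>) * \<eta>" using \<nu> by (intro mult_left_mono) auto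
      then show "norm (x n (Suc i) - x n i - (1 / real (Suc (k n))) *\<^sub>R F (x n i)) \<le> \<eta> / real (Suc (k n))"
        unfolding \<nu>_def[symmetric] eq using \<nu> by simp
    qed
  qed
  obtain r z where r: "strict_mono (r :: nat \<Rightarrow> nat)"
    and z: "\<And>t. t \<in> {0..1} \<Longrightarrow> (z has_vector_derivative F (z t)) (at t within {0..1})"
    and z0: "(\<lambda>n. x (r n) 0) \<longlonglongrightarrow> z 0" and z1: "(\<lambda>n. x (r n) (Suc (k (r n)))) \<longlonglongrightarrow> z 1"
    using euler_scheme_limit[OF Fc m _ xbd step] by auto
  define Q where "Q t = fst (z t)" for t
  define U where "U t = fst (snd (z t))" for t
  define A where "A t = fst (snd (snd (z t)))" for t
  define E where "E t = snd (snd (snd (z t)))" for t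
  have Fst: "((\<lambda>t. fst (f t)) has_vector_derivative fst D) (at t within X)" and
       Snd: "((\<lambda>t. snd (f t)) has_vector_derivative snd D) (at t within X)"
    if "(f has_vector_derivative D) (at t within X)" for f :: "real \<Rightarrow> 'c::real_normed_vector \<times> 'd::real_normed_vector" and D t X
    using bounded_linear.has_vector_derivative[OF bounded_linear_fst that] bounded_linear.has_vector_derivative[OF bounded_linear_snd that] by auto
  have dQ: "(Q has_vector_derivative Ti *\<^sub>R U t) (at t within {0..1})"
    and dU: "(U has_vector_derivative Ti *\<^sub>R g (Q t)) (at t within {0..1})"
    and dA: "(A has_vector_derivative Ti * W (Q t)) (at t within {0..1})"
    and dE: "(E has_vector_derivative Ti * ((norm (U t))\<^sup>2 / 2)) (at t within {0..1})" if "t \<in> {0..1}" for t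
    using Fst[OF z[OF that]] Fst[OF Snd[OF z[OF that]]] Fst[OF Snd[OF Snd[OF z[OF that]]]] Snd[OF Snd[OF Snd[OF z[OF that]]]]
    unfolding Q_def U_def A_def E_def F_def by simp_all
  have lim: "Q 0 = a" "Q 1 = b" "A 0 = 0" "E 0 = 0" "A 1 = E 1" "A 1 \<le> norm (b - a) * sqrt (C / 2)"
  proof -
    have "(\<lambda>n. fst (x (r n) 0)) \<longlonglongrightarrow> Q 0" unfolding Q_def by (intro tendsto_intros z0)
    then show "Q 0 = a" by (simp add: x_def q0 LIMSEQ_const_iff)
    have "(\<lambda>n. fst (x (r n) (Suc (k (r n))))) \<longlonglongrightarrow> Q 1" unfolding Q_def by (intro tendsto_intros z1)
    then show "Q 1 = b" by (simp add: x_def q1 LIMSEQ_const_iff)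
    have "(\<lambda>n. fst (snd (snd (x (r n) 0)))) \<longlonglongrightarrow> A 0" unfolding A_def by (intro tendsto_intros z0)
    then show "A 0 = 0" by (simp add: x_def LIMSEQ_const_iff)
    have "(\<lambda>n. snd (snd (snd (x (r n) 0)))) \<longlonglongrightarrow> E 0" unfolding E_def by (intro tendsto_intros z0)
    then show "E 0 = 0" by (simp add: x_def LIMSEQ_const_iff)
    have A1: "(\<lambda>n. fst (snd (snd (x (r n) (Suc (k (r n))))))) \<longlonglongrightarrow> A 1" unfolding A_def by (intro tendsto_intros z1)
    have E1: "(\<lambda>n. snd (snd (snd (x (r n) (Suc (k (r n))))))) \<longlonglongrightarrow> E 1" unfolding E_def by (intro tendsto_intros z1)
    have xA: "fst (snd (snd (x n (Suc (k n))))) = h (k n) * Pn (k n)" for n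
      unfolding x_def Pn_def P_def by simp
    have xE: "snd (snd (snd (x n (Suc (k n))))) = h (k n) * Pn (k n)" for n
    proof -
      have "(\<Sum>l<Suc (k n). (norm (v (k n) l))\<^sup>2 / 2) = Pn (k n)"
        unfolding sum_divide_distrib[symmetric] Sv by simp
      then show ?thesis unfolding x_def by simp
    qed
    show "A 1 = E 1" using A1 E1 unfolding xA xE by (rule LIMSEQ_unique)
    have "h n * Pn n \<le> norm (b - a) * sqrt (C / 2)" for n
    proof -
      have "(h n * Pn n)\<^sup>2 = (Sn n * Pn n) / 2" using h2[of n] by (simp add: power2_eq_square field_simps)
      also have "\<dots> \<le> (norm (b - a))\<^sup>2 * (C / 2)" using J[of n] by (simp add: Sn_def Pn_def field_simps)
      finally have "h n * Pn n \<le> sqrt ((norm (b - a))\<^sup>2 * (C / 2))" by (rule real_le_rsqrt)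
      then show ?thesis by (simp only: real_sqrt_mult real_sqrt_abs abs_norm_cancel)
    qed
    then show "A 1 \<le> norm (b - a) * sqrt (C / 2)" using A1 unfolding xA by (intro LIMSEQ_le_const2[OF A1[unfolded xA]]) auto
  qed
  have en: "(norm (U t))\<^sup>2 / 2 = W (Q t)" if t: "t \<in> {0..1}" for t
  proof -
    define H where "H t = (1/2) * (U t \<bullet> U t) - W (Q t)" for t
    have dH: "(H has_vector_derivative 0) (at t within {0..1})" if t: "t \<in> {0..1}" for t
    proof -
      have 1: "((\<lambda>t. W (Q t)) has_derivative (\<lambda>s. (s *\<^sub>R (Ti *\<^sub>R U t)) \<bullet> g (Q t))) (at t within {0..1})"
        using has_derivative_compose[OF dQ[OF t, unfolded has_vector_derivative_def] W[of "Q t", unfolded gderiv_def]] .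
      have 2: "(U has_derivative (\<lambda>s. s *\<^sub>R (Ti *\<^sub>R g (Q t)))) (at t within {0..1})"
        using dU[OF t] by (simp add: has_vector_derivative_def)
      show ?thesis
        unfolding H_def has_vector_derivative_def
        by (rule has_derivative_eq_rhs[OF has_derivative_diff[OF has_derivative_mult_right[OF has_derivative_inner[OF 2 2]] 1]])
          (simp add: fun_eq_iff inner_commute)
    qed
    obtain e where e: "\<And>t. t \<in> {0..1} \<Longrightarrow> H t = e"
      using has_vector_derivative_zero_constant[of "{0..1}" H] dH by auto
    \<comment> \<open>This expresses that \<open>E - A\<close> is affine with slope
      \<open>Ti * e\<close>; as it vanishes at both ends, \<open>e = 0\<close>.\<close>
    have "((\<lambda>t. E t - A t - t *\<^sub>R (Ti * e)) has_vector_derivative 0) (at t within {0..1})" if t: "t \<in> {0..1}" for t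
    proof -
      have "((\<lambda>t. E t - A t - t *\<^sub>R (Ti * e)) has_vector_derivative Ti * ((norm (U t))\<^sup>2 / 2) - Ti * W (Q t) - Ti * e) (at t within {0..1})"
        by (rule derivative_eq_intros dE[OF t] dA[OF t] refl | simp)+
      moreover have "Ti * ((norm (U t))\<^sup>2 / 2) - Ti * W (Q t) - Ti * e = Ti * (H t - e)"
        by (simp add: H_def power2_norm_eq_inner algebra_simps)
      ultimately show ?thesis using e[OF t] by simp
    qed
    then obtain e' where e': "\<And>t. t \<in> {0..1} \<Longrightarrow> E t - A t - t *\<^sub>R (Ti * e) = e'"
      using has_vector_derivative_zero_constant[of "{0..1}" "\<lambda>t. E t - A t - t *\<^sub>R (Ti * e)"] by auto
    have "e = 0" using e'[of 0] e'[of 1] lim Ti0 by simp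
    then show ?thesis using e[OF t] by (simp add: H_def power2_norm_eq_inner)
  qed
  have resc: "((\<lambda>t. f (t / Ti)) has_vector_derivative D) (at t within {0..Ti})"
    if "(f has_vector_derivative Ti *\<^sub>R D) (at (t / Ti) within {0..1})" "t \<in> {0..Ti}"
    for f :: "real \<Rightarrow> 'c::real_normed_vector" and D t
  proof -
    have im: "(\<lambda>t. t / Ti) ` {0..Ti} \<subseteq> {0..1}" using Ti0 by auto
    have "((\<lambda>t. t / Ti) has_vector_derivative 1 / Ti) (at t within {0..Ti})"
      by (rule derivative_eq_intros | use Ti0 in simp)+
    from vector_diff_chain_within[OF this has_vector_derivative_within_subset[OF that(1) im]]
    show ?thesis using Ti0 by (simp add: comp_def)
  qed
  have I: "t / Ti \<in> {0..1}" if "t \<in> {0..Ti}" for t using that Ti0 by auto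
  show thesis
  proof (rule that[of Ti "\<lambda>t. Q (t / Ti)" "\<lambda>t. A (t / Ti)" "\<lambda>t. U (t / Ti)"])
    show "((\<lambda>t. Q (t / Ti)) has_vector_derivative U (t / Ti)) (at t within {0..Ti})" if "t \<in> {0..Ti}" for t
      by (intro resc dQ I that)
    show "((\<lambda>t. U (t / Ti)) has_vector_derivative g (Q (t / Ti))) (at t within {0..Ti})" if "t \<in> {0..Ti}" for t
      by (intro resc dU I that)
    show "((\<lambda>t. A (t / Ti)) has_vector_derivative W (Q (t / Ti))) (at t within {0..Ti})" if "t \<in> {0..Ti}" for t
      using dA[OF I[OF that]] by (intro resc that) simp
  qed (use lim Ti0 en I in auto)
qed

section \<open>Motions of minimal action between the two parts of the sublevel set\<close>

text \<open>Composed with \<open>V - c\<close>, this gives a potential with continuous gradient and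
  positive lower bound that is unchanged where the excess is at least \<open>\<mu>\<close>. The
  identity is glued at \<open>\<mu>\<close> to an exponential with value \<open>\<mu>\<close> and
  slope 1 there and limit \<open>\<mu> / 2\<close> at minus infinity.\<close>

lemma truncation_exists:
  fixes \<mu> :: real
  assumes "\<mu> > 0"
  obtains \<phi> \<phi>' where "\<And>s. (\<phi> has_real_derivative \<phi>' s) (at s)" "continuous_on UNIV \<phi>'"
    "\<And>s. s \<ge> \<mu> \<Longrightarrow> \<phi> s = s" "\<And>s. s \<ge> \<mu> \<Longrightarrow> \<phi>' s = 1" "\<And>s. \<mu> / 2 \<le> \<phi> s" "\<And>s. \<phi> s \<le> max s \<mu>"
proof -
  define f where "f s = \<mu> / 2 * (1 + exp (2 * (s - \<mu>) / \<mu>))" for s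
  define E where "E s = exp (2 * (s - \<mu>) / \<mu>)" for s
  define \<phi> where "\<phi> s = (if s \<in> {..\<mu>} then f s else s)" for s
  define \<phi>' where "\<phi>' s = exp (2 * (min s \<mu> - \<mu>) / \<mu>)" for s
  have df: "(f has_vector_derivative E s) (at s within X)" for s X
    unfolding f_def E_def has_real_derivative_iff_has_vector_derivative[symmetric]
    by (rule derivative_eq_intros refl | use assms in simp)+
  have f_eq: "f \<mu> = \<mu>" "E \<mu> = 1" by (simp_all add: f_def E_def)
  have "(\<phi> has_vector_derivative (if s \<in> {..\<mu>} then E s else 1)) (at s within UNIV)" for s
    unfolding \<phi>_def
    by (rule has_vector_derivative_If_within_closures[where T = "{\<mu><..}"])
      (use assms f_eq in \<open>auto intro: df has_vector_derivative_id\<close>)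
  moreover have "(if s \<in> {..\<mu>} then E s else 1) = \<phi>' s" for s by (auto simp: \<phi>'_def E_def)
  ultimately have 1: "(\<phi> has_real_derivative \<phi>' s) (at s)" for s
    by (simp add: has_real_derivative_iff_has_vector_derivative)
  have f1: "\<mu> / 2 \<le> f s" for s using assms by (simp add: f_def)
  have f2: "f s \<le> \<mu>" if "s \<le> \<mu>" for s
  proof -
    have "exp (2 * (s - \<mu>) / \<mu>) \<le> 1" using that assms by (simp add: divide_nonpos_pos)
    then show ?thesis using assms by (simp add: f_def)
  qed
  show thesis
  proof (rule that[of \<phi> \<phi>'])
    show "continuous_on UNIV \<phi>'" unfolding \<phi>'_def using assms by (intro continuous_intros) auto
  qed (use 1 f1 f2 assms in \<open>auto simp: \<phi>_def \<phi>'_def f_def max_def min_def\<close>)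
qed

lemma first_time:
  fixes f :: "real \<Rightarrow> real"
  assumes "continuous_on {a..b} f" "s \<in> {a..b}" "f s \<le> r"
  obtains t where "t \<in> {a..b}" "f t \<le> r" "\<And>u. u \<in> {a..b} \<Longrightarrow> f u \<le> r \<Longrightarrow> t \<le> u"
proof -
  have "compact ({a..b} \<inter> f -` {..r})"
    using continuous_closed_preimage[OF assms(1), of "{..r}"]
    by (simp add: compact_eq_bounded_closed bounded_Int)
  moreover have "s \<in> {a..b} \<inter> f -` {..r}" using assms by auto
  ultimately obtain t where "t \<in> {a..b} \<inter> f -` {..r}" "\<forall>u\<in>{a..b} \<inter> f -` {..r}. t \<le> u"
    using compact_attains_inf by (metis empty_iff)
  then show thesis by (intro that[of t]) auto
qed

lemma last_time:
  fixes f :: "real \<Rightarrow> real"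
  assumes "continuous_on {a..b} f" "s \<in> {a..b}" "f s \<le> r"
  obtains t where "t \<in> {a..b}" "f t \<le> r" "\<And>u. u \<in> {a..b} \<Longrightarrow> f u \<le> r \<Longrightarrow> u \<le> t"
proof -
  have "compact ({a..b} \<inter> f -` {..r})"
    using continuous_closed_preimage[OF assms(1), of "{..r}"]
    by (simp add: compact_eq_bounded_closed bounded_Int)
  moreover have "s \<in> {a..b} \<inter> f -` {..r}" using assms by auto
  ultimately obtain t where "t \<in> {a..b} \<inter> f -` {..r}" "\<forall>u\<in>{a..b} \<inter> f -` {..r}. u \<le> t"
    using compact_attains_sup by (metis empty_iff)
  then show thesis by (intro that[of t]) auto
qed

section \<open>Geometry of the sublevel set\<close>

locale split_sublevel =
  fixes V :: "'a::euclidean_space \<Rightarrow> real" and g :: "'a \<Rightarrow> 'a" and c :: real and Vm Vp :: "'a set"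
  assumes gderiv: "\<And>x. GDERIV V x :> g x" and g_cont: "continuous_on UNIV g"
    and bounded_superlevel: "bounded {x. c < V x}"
    and closed_parts: "closed Vm" "closed Vp" and nonempty_parts: "Vm \<noteq> {}" "Vp \<noteq> {}"
    and sublevel_eq: "{x. V x \<le> c} = Vm \<union> Vp" and gap: "0 < setdist Vm Vp"
begin

lemma V_cont: "continuous_on S V"
  using gderiv unfolding gderiv_def by (meson continuous_at_imp_continuous_on has_derivative_continuous)

lemma sublevel_iff: "V x \<le> c \<longleftrightarrow> x \<in> Vm \<or> x \<in> Vp"
  using sublevel_eq by (metis Un_iff mem_Collect_eq)

lemma superlevel_in_ball: obtains R where "R > 0" "\<And>x. c < V x \<Longrightarrow> norm x \<le> R"
proof -
  obtain R where "R > 0" "\<forall>x\<in>{x. c < V x}. norm x \<le> R"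
    using bounded_superlevel unfolding bounded_pos by blast
  then show thesis by (intro that[of R]) auto
qed

lemma infdist_sum: "setdist Vm Vp \<le> infdist x Vm + infdist x Vp"
proof -
  obtain a where "a \<in> Vm" "infdist x Vm = dist x a"
    using infdist_attains_inf[OF closed_parts(1) nonempty_parts(1)] by metis
  moreover obtain b where "b \<in> Vp" "infdist x Vp = dist x b"
    using infdist_attains_inf[OF closed_parts(2) nonempty_parts(2)] by metis
  ultimately show ?thesis using setdist_le_dist[of a Vm b Vp] dist_triangle3[of a b x] by simp
qed

lemma height_bounded: obtains C where "C > 0" "\<And>x. V x - c \<le> C"
proof -
  obtain R where R: "R > 0" "\<And>x. c < V x \<Longrightarrow> norm x \<le> R" by (rule superlevel_in_ball) blast
  have "compact (V ` cball 0 R)" by (intro compact_continuous_image V_cont) simp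
  then obtain B where B: "\<And>x. x \<in> cball 0 R \<Longrightarrow> norm (V x) \<le> B"
    by (meson bounded_iff compact_imp_bounded imageI)
  show thesis
  proof (rule that[of "max (B - c) 1"])
    fix x show "V x - c \<le> max (B - c) 1"
      using R(2)[of x] B[of x] by (cases "c < V x") auto
  qed simp
qed

text \<open>The points in question form a compact subset of the superlevel set, so \<open>V\<close>
  attains a minimum above \<open>c\<close> on it. This is what turns bounds on action into bounds on
  time: away from both parts the action grows at least at rate \<open>\<mu>\<close>.\<close>

lemma uniform_excess:
  assumes "\<rho> > 0"
  obtains \<mu> where "\<mu> > 0" "\<And>x. \<rho> \<le> infdist x Vm \<Longrightarrow> \<rho> \<le> infdist x Vp \<Longrightarrow> c + \<mu> \<le> V x"
proof -
  define X where "X = {x. \<rho> \<le> infdist x Vm} \<inter> {x. \<rho> \<le> infdist x Vp}"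
  have pos: "c < V x" if "x \<in> X" for x
  proof (rule ccontr)
    assume "\<not> c < V x"
    then have "x \<in> Vm \<or> x \<in> Vp" using sublevel_iff by (simp add: not_less)
    then have "infdist x Vm = 0 \<or> infdist x Vp = 0" by auto
    then show False using that assms by (auto simp: X_def)
  qed
  have "closed X" unfolding X_def
    by (intro closed_Int closed_Collect_le continuous_on_const continuous_on_infdist continuous_on_id)
  moreover have "bounded X" by (rule bounded_subset[OF bounded_superlevel]) (use pos in auto)
  ultimately have "compact X" by (simp add: compact_eq_bounded_closed)
  have memX: "x \<in> X" if "\<rho> \<le> infdist x Vm" "\<rho> \<le> infdist x Vp" for x
    using that by (simp add: X_def)
  show thesis
  proof (cases "X = {}")
    case True
    then show thesis using memX by (intro that[of 1]) (simp, metis empty_iff)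
  next
    case False
    obtain x0 where x0: "x0 \<in> X" "\<forall>x\<in>X. V x0 \<le> V x"
      using continuous_attains_inf[OF \<open>compact X\<close> False V_cont] by metis
    have "c + (V x0 - c) \<le> V x" if "\<rho> \<le> infdist x Vm" "\<rho> \<le> infdist x Vp" for x
      using x0(2) memX[OF that] by simp
    with pos[OF x0(1)] show thesis by (intro that[of "V x0 - c"]) simp_all
  qed
qed

text \<open>The two parts cannot both be bounded, so uniform continuity of \<open>V\<close> near
  them is not immediate. But \<open>c < V x\<close> confines \<open>x\<close> to a fixed ball, and a
  nearest point of the part then lies in the ball of radius one larger. The lemma makes the end
  speeds small, as the squared speed is twice the excess.\<close>

lemma excess_small:
  assumes "\<eta> > 0"
  obtains \<epsilon> where "\<epsilon> > 0"
    "\<And>x. c < V x \<Longrightarrow> infdist x Vm \<le> \<epsilon> \<or> infdist x Vp \<le> \<epsilon> \<Longrightarrow> V x < c + \<eta>"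
proof -
  obtain R where R: "R > 0" "\<And>x. c < V x \<Longrightarrow> norm x \<le> R" by (rule superlevel_in_ball) blast
  have "uniformly_continuous_on (cball 0 (R + 1)) V"
    by (intro compact_uniformly_continuous V_cont) simp
  then obtain d where d: "d > 0" "\<And>x y. x \<in> cball 0 (R + 1) \<Longrightarrow> y \<in> cball 0 (R + 1) \<Longrightarrow> dist y x < d \<Longrightarrow> dist (V y) (V x) < \<eta>"
    using assms unfolding uniformly_continuous_on_def by meson
  have *: "V x < c + \<eta>" if x: "c < V x" "infdist x A \<le> min (d/2) 1" and A: "closed A" "A \<noteq> {}" "A \<subseteq> {x. V x \<le> c}" for x A
  proof -
    obtain a where a: "a \<in> A" "infdist x A = dist x a" using infdist_attains_inf[OF A(1,2)] by metis
    have "norm a \<le> norm x + dist x a" by (simp add: dist_norm norm_triangle_sub norm_minus_commute)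
    then have "dist (V x) (V a) < \<eta>" using d(2)[of a x] d(1) R(2)[OF x(1)] a x by auto
    then show ?thesis using a A by (auto simp: dist_real_def)
  qed
  show thesis
  proof (rule that[of "min (d/2) 1"])
    have "Vm \<subseteq> {x. V x \<le> c}" "Vp \<subseteq> {x. V x \<le> c}" by (auto simp: sublevel_iff)
    then show "V x < c + \<eta>" if "c < V x" "infdist x Vm \<le> min (d/2) 1 \<or> infdist x Vp \<le> min (d/2) 1" for x
      using *[OF that(1)] that(2) closed_parts nonempty_parts by blast
  qed (use d in auto)
qed

section \<open>Trajectories of energy -c outside the sublevel set\<close>

text \<open>\<open>w\<close> is a primitive of \<open>V - c\<close> along \<open>q\<close>, so differences of \<open>w\<close> are half the action.\<close>

definition motion :: "real set \<Rightarrow> (real \<Rightarrow> 'a) \<Rightarrow> (real \<Rightarrow> 'a) \<Rightarrow> (real \<Rightarrow> real) \<Rightarrow> bool" where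
  "motion I q v w \<longleftrightarrow> (\<forall>t\<in>I. c < V (q t) \<and> (norm (v t))\<^sup>2 / 2 = V (q t) - c \<and>
     (q has_vector_derivative v t) (at t within I) \<and>
     (v has_vector_derivative g (q t)) (at t within I) \<and>
     (w has_vector_derivative V (q t) - c) (at t within I))"

lemma motion_subset: "motion I q v w \<Longrightarrow> J \<subseteq> I \<Longrightarrow> motion J q v w"
  unfolding motion_def by (meson has_vector_derivative_within_subset subsetD)

lemma motion_shift:
  assumes "motion {a..b} q v w"
  shows "motion {a - \<tau>..b - \<tau>} (\<lambda>t. q (t + \<tau>)) (\<lambda>t. v (t + \<tau>)) (\<lambda>t. w (t + \<tau>))"
proof -
  have *: "((\<lambda>t. f (t + \<tau>)) has_vector_derivative D) (at t within {a - \<tau>..b - \<tau>})"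
    if f: "(f has_vector_derivative D) (at (t + \<tau>) within {a..b})"
    for f :: "real \<Rightarrow> 'c::real_normed_vector" and D t
  proof -
    have "((\<lambda>t. t + \<tau>) has_vector_derivative 1) (at t within {a - \<tau>..b - \<tau>})"
      by (rule derivative_eq_intros refl | simp)+
    from vector_diff_chain_within[OF this has_vector_derivative_within_subset[OF f]] show ?thesis
      by (simp add: comp_def)
  qed
  show ?thesis unfolding motion_def
  proof (intro ballI conjI *)
    fix t assume "t \<in> {a - \<tau>..b - \<tau>}"
    then have t: "t + \<tau> \<in> {a..b}" by auto
    note m = bspec[OF assms[unfolded motion_def] t]
    show "c < V (q (t + \<tau>))" "(norm (v (t + \<tau>)))\<^sup>2 / 2 = V (q (t + \<tau>)) - c"
      "(q has_vector_derivative v (t + \<tau>)) (at (t + \<tau>) within {a..b})"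
      "(v has_vector_derivative g (q (t + \<tau>))) (at (t + \<tau>) within {a..b})"
      "(w has_vector_derivative V (q (t + \<tau>)) - c) (at (t + \<tau>) within {a..b})"
      using m by auto
  qed
qed

lemma motion_cont: "motion I q v w \<Longrightarrow> continuous_on I q"
  unfolding motion_def continuous_on_eq_continuous_within
  by (meson has_vector_derivative_continuous)

lemma motion_action:
  assumes m: "motion {a..b} q v w" and st: "a \<le> s" "s \<le> t" "t \<le> b"
    and \<mu>: "\<And>u. s < u \<Longrightarrow> u < t \<Longrightarrow> c + \<mu> \<le> V (q u)"
  shows "\<mu> * (t - s) \<le> w t - w s"
proof (cases "s = t")
  case False
  then have "s < t" using st by simp
  then obtain u where u: "u \<in> {s<..<t}" "w t - w s = (t - s) *\<^sub>R (V (q u) - c)"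
    using mvt_simple[of s t w "\<lambda>u h. h *\<^sub>R (V (q u) - c)"] motion_subset[OF m, of "{s..t}"] st
    unfolding motion_def has_vector_derivative_def by auto
  have "\<mu> * (t - s) \<le> (V (q u) - c) * (t - s)"
    using \<mu>[of u] u st by (intro mult_right_mono) auto
  then show ?thesis using u by (simp add: mult.commute)
qed simp

lemma motion_action_mono:
  assumes m: "motion {a..b} q v w" and st: "a \<le> s" "s \<le> t" "t \<le> b"
  shows "w s \<le> w t"
proof -
  have "c + 0 \<le> V (q u)" if "s < u" "u < t" for u
    using bspec[OF m[unfolded motion_def], of u] st that by auto
  from motion_action[OF m st this] show ?thesis by simp
qed

text \<open>The energy identity turns the height bound into a speed bound with one constant for all
  motions, so that durations are bounded below by distances travelled.\<close>

lemma motion_speed: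
  obtains K where "K > 0" "\<And>I q v w t. motion I q v w \<Longrightarrow> t \<in> I \<Longrightarrow> norm (v t) \<le> K"
    "\<And>a b q v w s t. motion {a..b} q v w \<Longrightarrow> s \<in> {a..b} \<Longrightarrow> t \<in> {a..b} \<Longrightarrow> dist (q t) (q s) \<le> K * \<bar>t - s\<bar>"
proof -
  obtain C where C: "C > 0" "\<And>x. V x - c \<le> C" by (rule height_bounded) blast
  have 1: "norm (v t) \<le> sqrt (2 * C)" if "motion I q v w" "t \<in> I" for I q v w t
  proof (rule real_le_rsqrt)
    have "(norm (v t))\<^sup>2 / 2 = V (q t) - c" using that by (auto simp: motion_def)
    then show "(norm (v t))\<^sup>2 \<le> 2 * C" using C(2)[of "q t"] by simp
  qed
  have 2: "dist (q t) (q s) \<le> sqrt (2 * C) * \<bar>t - s\<bar>" if m: "motion {a..b} q v w" "s \<in> {a..b}" "t \<in> {a..b}" for a b q v w s t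
    using has_vector_derivative_lipschitz[of "{a..b}" q v "sqrt (2 * C)" s t] 1[OF m(1)] m
    by (auto simp: motion_def dist_norm)
  show thesis using C 1 2 by (intro that[of "sqrt (2 * C)"]) auto
qed

text \<open>On the way the distance to \<open>Vp\<close> passes through half the gap. While it lies
  between one and two thirds of the gap, the point is at least a third of the gap away from both
  parts, so the excess is bounded below; and bounded speed makes this phase last a fixed
  time.\<close>

lemma crossing_cost:
  obtains \<kappa> where "\<kappa> > 0"
    "\<And>a b q v w s t. motion {a..b} q v w \<Longrightarrow> a \<le> s \<Longrightarrow> s \<le> t \<Longrightarrow> t \<le> b \<Longrightarrow>
       infdist (q s) Vp \<le> setdist Vm Vp / 3 \<Longrightarrow> infdist (q t) Vm \<le> setdist Vm Vp / 3 \<Longrightarrow> \<kappa> \<le> w t - w s"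
proof -
  define d where "d = setdist Vm Vp"
  have d: "d > 0" using gap by (simp add: d_def)
  then have d3: "d / 3 > 0" by simp
  obtain \<mu> where \<mu>: "\<mu> > 0" "\<And>x. d/3 \<le> infdist x Vm \<Longrightarrow> d/3 \<le> infdist x Vp \<Longrightarrow> c + \<mu> \<le> V x"
    by (rule uniform_excess[OF d3]) blast
  obtain K where K: "K > 0" "\<And>a b q v w s t. motion {a..b} q v w \<Longrightarrow> s \<in> {a..b} \<Longrightarrow> t \<in> {a..b} \<Longrightarrow> dist (q t) (q s) \<le> K * \<bar>t - s\<bar>"
    using motion_speed by metis
  \<comment> \<open>The least time in which the distance to \<open>Vp\<close> can grow from a third
    to a half of the gap at speed \<open>K\<close>.\<close>
  define h where "h = d / (6 * K)"
  have h: "h > 0" "K * h = d / 6" using K d by (simp_all add: h_def)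
  show thesis
  proof (rule that[of "\<mu> * h"])
    show "\<mu> * h > 0" using \<mu> h by simp
    fix a b q v w s t
    assume m: "motion {a..b} q v w" and st: "a \<le> s" "s \<le> t" "t \<le> b"
      and sp: "infdist (q s) Vp \<le> setdist Vm Vp / 3" and tm: "infdist (q t) Vm \<le> setdist Vm Vp / 3"
    have tp: "2 * d / 3 \<le> infdist (q t) Vp" using infdist_sum[of "q t"] tm by (simp add: d_def)
    have "continuous_on {s..t} (\<lambda>r. infdist (q r) Vp)"
      by (intro continuous_on_infdist continuous_on_subset[OF motion_cont[OF m]]) (use st in auto)
    then obtain r where r: "s \<le> r" "r \<le> t" "infdist (q r) Vp = d / 2"
      using IVT'[of "\<lambda>r. infdist (q r) Vp" s "d/2" t] sp tp d st by (auto simp: d_def)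
    have close: "\<bar>infdist (q u) Vp - d/2\<bar> \<le> K * (r - u)" if "s \<le> u" "u \<le> r" for u
      using infdist_triangle_abs[of "q u" Vp "q r"] K(2)[OF m, of u r] that r st by (auto simp: dist_commute)
    have "d / 6 \<le> K * (r - s)" using close[of s] r sp by (simp add: d_def)
    then have "K * h \<le> K * (r - s)" using h by simp
    then have hr: "s \<le> r - h" using K by simp
    have "\<mu> * (r - (r - h)) \<le> w r - w (r - h)"
    proof (rule motion_action[OF m])
      fix u assume u: "r - h < u" "u < r"
      have "K * (r - u) \<le> K * h" using u K by (intro mult_left_mono) auto
      then have "\<bar>infdist (q u) Vp - d/2\<bar> \<le> d / 6" using close[of u] u hr h by simp
      then have "d/3 \<le> infdist (q u) Vp" "infdist (q u) Vp \<le> 2*d/3" by linarith+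
      then show "c + \<mu> \<le> V (q u)" using infdist_sum[of "q u"] by (intro \<mu>) (auto simp: d_def)
    qed (use hr r st h in auto)
    moreover have "w s \<le> w (r - h)" "w r \<le> w t" using motion_action_mono[OF m] hr r st h by auto
    ultimately show "\<mu> * h \<le> w t - w s" by simp
  qed
qed

text \<open>Connect a point of \<open>Vm\<close> to one of \<open>Vp\<close> in the truncated
  potential, then cut at the first approach to \<open>Vp\<close> and at the last approach to
  \<open>Vm\<close> before it. In between the truncation is inactive. The action bound involves only
  the upper bound of the potential, hence not \<open>\<epsilon>\<close>.\<close>

lemma motion_exists:
  obtains M where "\<And>\<epsilon>. \<epsilon> > 0 \<Longrightarrow> \<exists>a b q v w. a \<le> b \<and> motion {a..b} q v w \<and>
    infdist (q a) Vm \<le> \<epsilon> \<and> infdist (q b) Vp \<le> \<epsilon> \<and> w b - w a \<le> M"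
proof -
  obtain C where C: "C > 0" "\<And>x. V x - c \<le> C" by (rule height_bounded) blast
  obtain a b where ab: "a \<in> Vm" "b \<in> Vp" using nonempty_parts by auto
  have neq: "a \<noteq> b" using setdist_le_dist[OF ab] gap by auto
  show thesis
  proof (rule that[of "norm (b - a) * sqrt ((C + 1) / 2)"])
    fix \<epsilon>0 :: real assume "\<epsilon>0 > 0"
    \<comment> \<open>Below half the gap no point is \<open>\<epsilon>\<close>-close to both parts,
      so the two cutting times will differ.\<close>
    define \<epsilon> where "\<epsilon> = min \<epsilon>0 (setdist Vm Vp / 3)"
    have \<epsilon>: "\<epsilon> > 0" "\<epsilon> \<le> \<epsilon>0" "\<epsilon> \<le> setdist Vm Vp / 3" using \<open>\<epsilon>0 > 0\<close> gap by (auto simp: \<epsilon>_def)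
    obtain \<mu>0 where \<mu>0: "\<mu>0 > 0" "\<And>x. \<epsilon> \<le> infdist x Vm \<Longrightarrow> \<epsilon> \<le> infdist x Vp \<Longrightarrow> c + \<mu>0 \<le> V x"
      by (rule uniform_excess[OF \<epsilon>(1)]) blast
    \<comment> \<open>Capping at 1 keeps the truncated potential below \<open>C + 1\<close> for
      every \<open>\<epsilon>\<close>.\<close>
    define \<mu> where "\<mu> = min \<mu>0 1"
    have \<mu>: "\<mu> > 0" "\<mu> \<le> 1" "\<And>x. \<epsilon> \<le> infdist x Vm \<Longrightarrow> \<epsilon> \<le> infdist x Vp \<Longrightarrow> c + \<mu> \<le> V x"
    proof -
      show "\<mu> > 0" "\<mu> \<le> 1" using \<mu>0(1) by (simp_all add: \<mu>_def)
      show "c + \<mu> \<le> V x" if "\<epsilon> \<le> infdist x Vm" "\<epsilon> \<le> infdist x Vp" for x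
        using \<mu>0(2)[OF that] by (simp add: \<mu>_def)
    qed
    obtain \<phi> \<phi>' where \<phi>: "\<And>s. (\<phi> has_real_derivative \<phi>' s) (at s)" "continuous_on UNIV \<phi>'"
      "\<And>s. s \<ge> \<mu> \<Longrightarrow> \<phi> s = s" "\<And>s. s \<ge> \<mu> \<Longrightarrow> \<phi>' s = 1" "\<And>s. \<mu> / 2 \<le> \<phi> s" "\<And>s. \<phi> s \<le> max s \<mu>"
      by (rule truncation_exists[OF \<mu>(1)]) blast
    define W where "W x = \<phi> (V x - c)" for x
    define G where "G x = \<phi>' (V x - c) *\<^sub>R g x" for x
    have W: "GDERIV W x :> G x" for x
    proof -
      have "GDERIV (\<lambda>x. V x - c) x :> g x - 0" by (intro GDERIV_diff gderiv GDERIV_const)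
      then have "GDERIV (\<lambda>x. V x - c) x :> g x" by simp
      from GDERIV_DERIV_compose[OF this \<phi>(1)] show ?thesis unfolding W_def G_def .
    qed
    have Gc: "continuous_on UNIV G" unfolding G_def
      by (intro continuous_intros continuous_on_compose2[OF \<phi>(2)] V_cont g_cont) auto
    have Wup: "W x \<le> C + 1" for x using \<phi>(6)[of "V x - c"] C(2)[of x] C(1) \<mu> by (auto simp: W_def)
    have Wlow: "\<mu> / 2 \<le> W x" for x using \<phi>(5) by (simp add: W_def)
    have "\<mu> / 2 > 0" using \<mu> by simp
    obtain T q v w where T: "T > 0" "q 0 = a" "q T = b" and wT: "w T - w 0 \<le> norm (b - a) * sqrt ((C + 1) / 2)"
      and dq: "\<And>t. t \<in> {0..T} \<Longrightarrow> (q has_vector_derivative v t) (at t within {0..T})"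
      and dv: "\<And>t. t \<in> {0..T} \<Longrightarrow> (v has_vector_derivative G (q t)) (at t within {0..T})"
      and dw: "\<And>t. t \<in> {0..T} \<Longrightarrow> (w has_vector_derivative W (q t)) (at t within {0..T})"
      and en: "\<And>t. t \<in> {0..T} \<Longrightarrow> (norm (v t))\<^sup>2 / 2 = W (q t)"
      by (rule positive_potential_connection[OF W Gc Wlow Wup \<open>\<mu> / 2 > 0\<close> neq]) blast
    have qc: "continuous_on {0..T} q"
      unfolding continuous_on_eq_continuous_within using dq has_vector_derivative_continuous by blast
    have "continuous_on {0..T} (\<lambda>t. infdist (q t) Vp)" by (intro continuous_on_infdist qc)
    moreover have "T \<in> {0..T}" "infdist (q T) Vp \<le> \<epsilon>" using T ab(2) \<epsilon>(1) by simp_all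
    ultimately obtain tp where tp: "tp \<in> {0..T}" "infdist (q tp) Vp \<le> \<epsilon>"
        "\<And>u. u \<in> {0..T} \<Longrightarrow> infdist (q u) Vp \<le> \<epsilon> \<Longrightarrow> tp \<le> u"
      by (rule first_time) blast
    have "continuous_on {0..tp} (\<lambda>t. infdist (q t) Vm)"
      by (intro continuous_on_infdist continuous_on_subset[OF qc]) (use tp(1) in simp)
    moreover have "0 \<in> {0..tp}" "infdist (q 0) Vm \<le> \<epsilon>" using T tp(1) ab(1) \<epsilon>(1) by simp_all
    ultimately obtain tm where tm: "tm \<in> {0..tp}" "infdist (q tm) Vm \<le> \<epsilon>"
        "\<And>u. u \<in> {0..tp} \<Longrightarrow> infdist (q u) Vm \<le> \<epsilon> \<Longrightarrow> u \<le> tm"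
      by (rule last_time) blast
    have "tm \<noteq> tp" using infdist_sum[of "q tm"] tm(2) tp(2) \<epsilon>(3) gap by (cases "tm = tp") simp_all
    then have mp: "tm < tp" using tm by auto
    \<comment> \<open>Strictly between the cutting times both distances are at least
      \<open>\<epsilon>\<close>; the two endpoints follow by continuity.\<close>
    have exc: "c + \<mu> \<le> V (q t)" if t: "t \<in> {tm..tp}" for t
    proof -
      have "continuous_on {tm..tp} (\<lambda>t. V (q t))"
        by (rule continuous_on_compose2[OF V_cont continuous_on_subset[OF qc]]) (use tm tp in auto)
      moreover have "c + \<mu> \<le> V (q u)" if "u \<in> {tm<..<tp}" for u
      proof (rule \<mu>(3))
        have u: "u \<in> {0..tp}" "u \<in> {0..T}" using that tm(1) tp(1) by auto
        show "\<epsilon> \<le> infdist (q u) Vm" using tm(3)[OF u(1)] that by (cases "infdist (q u) Vm \<le> \<epsilon>") auto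
        show "\<epsilon> \<le> infdist (q u) Vp" using tp(3)[OF u(2)] that by (cases "infdist (q u) Vp \<le> \<epsilon>") auto
      qed
      ultimately show ?thesis
        using continuous_ge_on_closure[of "{tm<..<tp}" "\<lambda>t. V (q t)" t "c + \<mu>"] t mp by auto
    qed
    have sub: "{tm..tp} \<subseteq> {0..T}" using tm tp by auto
    have "motion {tm..tp} q v w" unfolding motion_def
    proof (intro ballI conjI)
      fix t assume t: "t \<in> {tm..tp}"
      then have t0: "t \<in> {0..T}" using sub by auto
      have e: "V (q t) - c \<ge> \<mu>" using exc[OF t] by simp
      have We: "W (q t) = V (q t) - c" and Ge: "G (q t) = g (q t)" using \<phi>(3,4)[OF e] by (simp_all add: W_def G_def)
      show "c < V (q t)" using e \<mu>(1) by simp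
      show "(norm (v t))\<^sup>2 / 2 = V (q t) - c" using en[OF t0] We by simp
      show "(q has_vector_derivative v t) (at t within {tm..tp})" by (rule has_vector_derivative_within_subset[OF dq[OF t0] sub])
      show "(v has_vector_derivative g (q t)) (at t within {tm..tp})" using has_vector_derivative_within_subset[OF dv[OF t0] sub] Ge by simp
      show "(w has_vector_derivative V (q t) - c) (at t within {tm..tp})" using has_vector_derivative_within_subset[OF dw[OF t0] sub] We by simp
    qed
    moreover have "w tp - w tm \<le> norm (b - a) * sqrt ((C + 1) / 2)"
    proof -
      \<comment> \<open>The truncated potential is positive, so discarding the outer pieces cannot
        increase the action.\<close>
      have mono: "w s \<le> w t" if "0 \<le> s" "s \<le> t" "t \<le> T" for s t
      proof (cases "s = t")
        case False
        have "\<exists>u\<in>{s<..<t}. w t - w s = (t - s) *\<^sub>R W (q u)"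
        proof (rule mvt_simple)
          fix u assume "s \<le> u" "u \<le> t"
          then show "(w has_derivative (\<lambda>h. h *\<^sub>R W (q u))) (at u within {s..t})"
            using has_vector_derivative_within_subset[OF dw[of u], of "{s..t}"] that unfolding has_vector_derivative_def by auto
        qed (use that False in auto)
        then obtain u where "w t - w s = (t - s) * W (q u)" by auto
        moreover have "(t - s) * W (q u) \<ge> 0" using that Wlow[of "q u"] \<mu> by (intro mult_nonneg_nonneg) auto
        ultimately show ?thesis by simp
      qed simp
      show ?thesis using mono[of 0 tm] mono[of tp T] tm tp wT by auto
    qed
    ultimately show "\<exists>s t q v w. s \<le> t \<and> motion {s..t} q v w \<and> infdist (q s) Vm \<le> \<epsilon>0 \<and> infdist (q t) Vp \<le> \<epsilon>0 \<and>
        w t - w s \<le> norm (b - a) * sqrt ((C + 1) / 2)"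
      using tm(2) tp(2) \<epsilon>(2) mp by (intro exI[of _ tm] exI[of _ tp] exI[of _ q] exI[of _ v] exI[of _ w] conjI) simp_all
  qed
qed

section \<open>Trajectories of nearly minimal action\<close>

text \<open>Let \<open>\<kappa>\<close> be the cost of a crossing back and \<open>\<Sigma>\<close>
  the supremum of the infima \<open>\<sigma>\<close>. Choose \<open>\<rho>1\<close> with
  \<open>\<sigma> \<rho>1\<close> above \<open>\<Sigma> - \<kappa> / 2\<close> and motions of action
  below \<open>\<Sigma> + \<kappa> / 2\<close>. If such a motion returned towards \<open>Vm\<close>
  after a visit near \<open>Vp\<close>, its initial piece up to the visit would compete for
  \<open>\<sigma> \<rho>1\<close> with action below \<open>\<Sigma> - \<kappa> / 2\<close>.\<close>

lemma near_minimal_motions: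
  obtains \<rho>0 M where "\<rho>0 > 0" "\<rho>0 \<le> setdist Vm Vp / 3"
    "\<And>\<epsilon>. 0 < \<epsilon> \<Longrightarrow> \<epsilon> \<le> \<rho>0 \<Longrightarrow> \<exists>a b q v w. a \<le> b \<and> motion {a..b} q v w \<and>
      infdist (q a) Vm \<le> \<epsilon> \<and> infdist (q b) Vp \<le> \<epsilon> \<and> w b - w a \<le> M \<and>
      (\<forall>s t. a \<le> s \<longrightarrow> s \<le> t \<longrightarrow> t \<le> b \<longrightarrow> infdist (q t) Vm \<le> setdist Vm Vp / 3 \<longrightarrow> \<rho>0 < infdist (q s) Vp)"
proof -
  define d where "d = setdist Vm Vp"
  have d: "d > 0" using gap by (simp add: d_def)
  obtain M where M: "\<And>\<epsilon>. \<epsilon> > 0 \<Longrightarrow> \<exists>a b q v w. a \<le> b \<and> motion {a..b} q v w \<and>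
    infdist (q a) Vm \<le> \<epsilon> \<and> infdist (q b) Vp \<le> \<epsilon> \<and> w b - w a \<le> M"
    by (rule motion_exists) blast
  obtain \<kappa> where \<kappa>: "\<kappa> > 0"
    "\<And>a b q v w s t. motion {a..b} q v w \<Longrightarrow> a \<le> s \<Longrightarrow> s \<le> t \<Longrightarrow> t \<le> b \<Longrightarrow>
       infdist (q s) Vp \<le> d / 3 \<Longrightarrow> infdist (q t) Vm \<le> d / 3 \<Longrightarrow> \<kappa> \<le> w t - w s"
    unfolding d_def by (rule crossing_cost) blast
  \<comment> \<open>only trajectories are admitted as competitors, so that no comparison curves need to be built\<close>
  define act where "act \<epsilon> = {x. \<exists>a b q v w. a \<le> b \<and> motion {a..b} q v w \<and>
    infdist (q a) Vm \<le> \<epsilon> \<and> infdist (q b) Vp \<le> \<epsilon> \<and> x = w b - w a}" for \<epsilon>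
  define \<sigma> where "\<sigma> \<epsilon> = Inf (act \<epsilon>)" for \<epsilon>
  have nonneg: "0 \<le> x" if x: "x \<in> act \<epsilon>" for x \<epsilon>
  proof -
    obtain a b q v w where "a \<le> b" "motion {a..b} q v w" "x = w b - w a" using x unfolding act_def by blast
    then show ?thesis using motion_action_mono[of a b q v w a b] by simp
  qed
  have bdd: "bdd_below (act \<epsilon>)" for \<epsilon> using nonneg by (meson bdd_belowI)
  have low: "\<exists>x\<in>act \<epsilon>. x \<le> M" if "\<epsilon> > 0" for \<epsilon>
  proof -
    obtain a b q v w where "a \<le> b \<and> motion {a..b} q v w \<and>
      infdist (q a) Vm \<le> \<epsilon> \<and> infdist (q b) Vp \<le> \<epsilon> \<and> w b - w a \<le> M" using M[OF \<open>\<epsilon> > 0\<close>] by metis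
    then show ?thesis unfolding act_def by (intro bexI[of _ "w b - w a"]) blast+
  qed
  have \<sigma>M: "\<sigma> \<epsilon> \<le> M" if "\<epsilon> > 0" for \<epsilon>
    using low[OF that] cInf_lower[OF _ bdd] unfolding \<sigma>_def by (meson order_trans)
  \<comment> \<open>This is the limit of \<open>\<sigma>\<close> as \<open>\<epsilon>\<close> tends
    to 0, since fewer trajectories compete for smaller \<open>\<epsilon>\<close>.\<close>
  define \<Sigma> where "\<Sigma> = (SUP \<epsilon>\<in>{0<..}. \<sigma> \<epsilon>)"
  have bda: "bdd_above (\<sigma> ` {0<..})" using \<sigma>M by (intro bdd_aboveI[of _ M]) auto
  have \<sigma>\<Sigma>: "\<sigma> \<epsilon> \<le> \<Sigma>" if "\<epsilon> > 0" for \<epsilon> unfolding \<Sigma>_def using that by (intro cSUP_upper bda) auto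
  have "\<Sigma> - \<kappa> / 2 < \<Sigma>" using \<kappa> by simp
  then obtain \<rho>1 where \<rho>1: "\<rho>1 > 0" "\<Sigma> - \<kappa> / 2 < \<sigma> \<rho>1"
    unfolding \<Sigma>_def using less_cSUP_iff[OF _ bda, of "\<Sigma> - \<kappa> / 2"] by (auto simp: \<Sigma>_def)
  define \<rho>0 where "\<rho>0 = min \<rho>1 (d / 3)"
  have \<rho>0: "\<rho>0 > 0" "\<rho>0 \<le> d / 3" "\<rho>0 \<le> \<rho>1" using \<rho>1 d by (auto simp: \<rho>0_def)
  show thesis
  proof (rule that[of \<rho>0 "\<Sigma> + \<kappa> / 2"])
    show "\<rho>0 > 0" "\<rho>0 \<le> setdist Vm Vp / 3" using \<rho>0 by (simp_all add: d_def)
    fix \<epsilon> :: real assume \<epsilon>: "0 < \<epsilon>" "\<epsilon> \<le> \<rho>0"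
    have "\<exists>x\<in>act \<epsilon>. x < \<Sigma> + \<kappa> / 2"
    proof (rule cInf_lessD)
      show "act \<epsilon> \<noteq> {}" using low[OF \<epsilon>(1)] by auto
      show "Inf (act \<epsilon>) < \<Sigma> + \<kappa> / 2" using \<sigma>\<Sigma>[OF \<epsilon>(1)] \<kappa>(1) by (simp add: \<sigma>_def)
    qed
    then obtain a b q v w where m: "a \<le> b" "motion {a..b} q v w" "infdist (q a) Vm \<le> \<epsilon>" "infdist (q b) Vp \<le> \<epsilon>"
      and wab: "w b - w a < \<Sigma> + \<kappa> / 2" unfolding act_def by blast
    have "\<rho>0 < infdist (q s) Vp" if st: "a \<le> s" "s \<le> t" "t \<le> b" "infdist (q t) Vm \<le> d / 3" for s t
    proof (rule ccontr)
      assume "\<not> ?thesis"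
      then have s: "infdist (q s) Vp \<le> \<rho>0" by simp
      have "\<kappa> \<le> w t - w s" using \<kappa>(2)[OF m(2) st(1-3) _ st(4)] s \<rho>0 by simp
      moreover have "w t \<le> w b" using motion_action_mono[OF m(2), of t b] st by simp
      moreover have "w s - w a \<in> act \<rho>1"
      proof -
        have "motion {a..s} q v w" by (rule motion_subset[OF m(2)]) (use st in auto)
        then show ?thesis unfolding act_def using st(1) s \<rho>0 m \<epsilon>
          by (intro CollectI exI[of _ a] exI[of _ s] exI[of _ q] exI[of _ v] exI[of _ w] conjI) simp_all
      qed
      then have "\<sigma> \<rho>1 \<le> w s - w a" unfolding \<sigma>_def by (intro cInf_lower bdd)
      ultimately show False using wab \<rho>1(2) by simp
    qed
    then show "\<exists>a b q v w. a \<le> b \<and> motion {a..b} q v w \<and>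
      infdist (q a) Vm \<le> \<epsilon> \<and> infdist (q b) Vp \<le> \<epsilon> \<and> w b - w a \<le> \<Sigma> + \<kappa> / 2 \<and>
      (\<forall>s t. a \<le> s \<longrightarrow> s \<le> t \<longrightarrow> t \<le> b \<longrightarrow> infdist (q t) Vm \<le> setdist Vm Vp / 3 \<longrightarrow> \<rho>0 < infdist (q s) Vp)"
      using m wab unfolding d_def
      by (intro exI[of _ a] exI[of _ b] exI[of _ q] exI[of _ v] exI[of _ w] conjI) simp_all
  qed
qed

text \<open>Time 0 is placed at the last moment within a third of the gap from \<open>Vm\<close>.
  Each half of the time axis is then kept away from one part, so that only the distance to the other
  part can become small on it.\<close>

lemma centred_motions:
  obtains \<rho>0 M where "\<rho>0 > 0" "\<rho>0 \<le> setdist Vm Vp / 3"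
    "\<And>\<epsilon>. 0 < \<epsilon> \<Longrightarrow> \<epsilon> \<le> \<rho>0 \<Longrightarrow> \<exists>a b q v w. a \<le> 0 \<and> 0 \<le> b \<and> motion {a..b} q v w \<and>
      infdist (q a) Vm \<le> \<epsilon> \<and> infdist (q b) Vp \<le> \<epsilon> \<and> w b - w a \<le> M \<and>
      (\<forall>s. a \<le> s \<longrightarrow> s \<le> 0 \<longrightarrow> \<rho>0 < infdist (q s) Vp) \<and>
      (\<forall>t. 0 < t \<longrightarrow> t \<le> b \<longrightarrow> \<rho>0 < infdist (q t) Vm)"
proof -
  obtain \<rho>0 M where \<rho>0: "\<rho>0 > 0" "\<rho>0 \<le> setdist Vm Vp / 3" and ex:
    "\<And>\<epsilon>. 0 < \<epsilon> \<Longrightarrow> \<epsilon> \<le> \<rho>0 \<Longrightarrow> \<exists>a b q v w. a \<le> b \<and> motion {a..b} q v w \<and>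
      infdist (q a) Vm \<le> \<epsilon> \<and> infdist (q b) Vp \<le> \<epsilon> \<and> w b - w a \<le> M \<and>
      (\<forall>s t. a \<le> s \<longrightarrow> s \<le> t \<longrightarrow> t \<le> b \<longrightarrow> infdist (q t) Vm \<le> setdist Vm Vp / 3 \<longrightarrow> \<rho>0 < infdist (q s) Vp)"
    by (rule near_minimal_motions) blast
  show thesis
  proof (rule that[OF \<rho>0])
    fix \<epsilon> :: real assume \<epsilon>: "0 < \<epsilon>" "\<epsilon> \<le> \<rho>0"
    obtain a b q v w where m: "a \<le> b" "motion {a..b} q v w" "infdist (q a) Vm \<le> \<epsilon>" "infdist (q b) Vp \<le> \<epsilon>" "w b - w a \<le> M"
      and far: "\<And>s t. a \<le> s \<Longrightarrow> s \<le> t \<Longrightarrow> t \<le> b \<Longrightarrow> infdist (q t) Vm \<le> setdist Vm Vp / 3 \<Longrightarrow> \<rho>0 < infdist (q s) Vp"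
      using ex[OF \<epsilon>] by metis
    have "continuous_on {a..b} (\<lambda>t. infdist (q t) Vm)" by (intro continuous_on_infdist motion_cont[OF m(2)])
    moreover have "a \<in> {a..b}" "infdist (q a) Vm \<le> setdist Vm Vp / 3" using m \<epsilon> \<rho>0 by auto
    ultimately obtain \<tau> where \<tau>: "\<tau> \<in> {a..b}" "infdist (q \<tau>) Vm \<le> setdist Vm Vp / 3"
      "\<And>u. u \<in> {a..b} \<Longrightarrow> infdist (q u) Vm \<le> setdist Vm Vp / 3 \<Longrightarrow> u \<le> \<tau>"
      by (rule last_time) blast
    have "\<rho>0 < infdist (q (t + \<tau>)) Vm" if "0 < t" "t \<le> b - \<tau>" for t
    proof (rule ccontr)
      assume "\<not> ?thesis"
      then have "infdist (q (t + \<tau>)) Vm \<le> setdist Vm Vp / 3" using \<rho>0 by simp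
      then have "t + \<tau> \<le> \<tau>" using \<tau>(1) that by (intro \<tau>(3)) auto
      then show False using that by simp
    qed
    moreover have "\<rho>0 < infdist (q (s + \<tau>)) Vp" if "a - \<tau> \<le> s" "s \<le> 0" for s
      using far[of "s + \<tau>" \<tau>] \<tau> that by simp
    ultimately show "\<exists>a b q v w. a \<le> 0 \<and> 0 \<le> b \<and> motion {a..b} q v w \<and>
      infdist (q a) Vm \<le> \<epsilon> \<and> infdist (q b) Vp \<le> \<epsilon> \<and> w b - w a \<le> M \<and>
      (\<forall>s. a \<le> s \<longrightarrow> s \<le> 0 \<longrightarrow> \<rho>0 < infdist (q s) Vp) \<and>
      (\<forall>t. 0 < t \<longrightarrow> t \<le> b \<longrightarrow> \<rho>0 < infdist (q t) Vm)"
      using motion_shift[OF m(2), of \<tau>] m \<tau>(1)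
      by (intro exI[of _ "a - \<tau>"] exI[of _ "b - \<tau>"] exI[of _ "\<lambda>t. q (t + \<tau>)"] exI[of _ "\<lambda>t. v (t + \<tau>)"]
        exI[of _ "\<lambda>t. w (t + \<tau>)"] conjI) simp_all
  qed
qed

text \<open>These are the facts that survive the passage to the limit. The times of approach stay
  bounded because a motion that kept away from \<open>Vm\<close> on all of \<open>[-H, 0]\<close>,
  where it is far from \<open>Vp\<close> anyway, would spend more than the action \<open>M\<close>;
  likewise for \<open>Vp\<close> on \<open>[0, H]\<close>.\<close>

lemma connecting_sequence:
  obtains \<tau> a b q v w where "\<tau> > (0::real)"
    "\<And>n. motion {a n..b n} (q n) (v n) (w n)" "\<And>n::nat. a n \<le> 0" "\<And>n. 0 \<le> b n" "\<And>n. \<tau> \<le> b n - a n"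
    "\<And>e. e > 0 \<Longrightarrow> \<exists>N. \<forall>n\<ge>N. norm (v n (a n)) \<le> e \<and> norm (v n (b n)) \<le> e"
    "\<And>\<rho>. \<rho> > 0 \<Longrightarrow> \<exists>H N. \<forall>n\<ge>N. \<exists>s. s \<in> {a n..b n} \<and> \<bar>s\<bar> \<le> H \<and> infdist (q n s) Vm \<le> \<rho>"
    "\<And>\<rho>. \<rho> > 0 \<Longrightarrow> \<exists>H N. \<forall>n\<ge>N. \<exists>s. s \<in> {a n..b n} \<and> \<bar>s\<bar> \<le> H \<and> infdist (q n s) Vp \<le> \<rho>"
proof -
  define d where "d = setdist Vm Vp"
  have d: "d > 0" using gap by (simp add: d_def)
  obtain \<rho>0 M where \<rho>0: "\<rho>0 > 0" "\<rho>0 \<le> d / 3" and ex: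
    "\<And>\<epsilon>. 0 < \<epsilon> \<Longrightarrow> \<epsilon> \<le> \<rho>0 \<Longrightarrow> \<exists>a b q v w. a \<le> 0 \<and> 0 \<le> b \<and> motion {a..b} q v w \<and>
      infdist (q a) Vm \<le> \<epsilon> \<and> infdist (q b) Vp \<le> \<epsilon> \<and> w b - w a \<le> M \<and>
      (\<forall>s. a \<le> s \<longrightarrow> s \<le> 0 \<longrightarrow> \<rho>0 < infdist (q s) Vp) \<and>
      (\<forall>t. 0 < t \<longrightarrow> t \<le> b \<longrightarrow> \<rho>0 < infdist (q t) Vm)"
    unfolding d_def by (rule centred_motions) blast
  define \<epsilon> where "\<epsilon> n = min \<rho>0 (1 / real (Suc n))" for n
  have \<epsilon>: "0 < \<epsilon> n" "\<epsilon> n \<le> \<rho>0" for n using \<rho>0 by (auto simp: \<epsilon>_def)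
  have \<epsilon>0: "\<exists>N. \<forall>n\<ge>N. \<epsilon> n \<le> e" if e: "e > 0" for e
  proof -
    obtain N where N: "1 / real (Suc N) < e" using nat_approx_posE[OF e] by metis
    have "\<epsilon> n \<le> e" if "n \<ge> N" for n
    proof -
      have "1 / real (Suc n) \<le> 1 / real (Suc N)" using that by (intro divide_left_mono) auto
      then show ?thesis using N by (simp add: \<epsilon>_def)
    qed
    then show ?thesis by blast
  qed
  define good where "good \<epsilon> a b q v w \<longleftrightarrow> a \<le> 0 \<and> 0 \<le> b \<and> motion {a..b} q v w \<and>
      infdist (q a) Vm \<le> \<epsilon> \<and> infdist (q b) Vp \<le> \<epsilon> \<and> w b - w a \<le> M \<and>
      (\<forall>s. a \<le> s \<longrightarrow> s \<le> 0 \<longrightarrow> \<rho>0 < infdist (q s) Vp) \<and>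
      (\<forall>t. 0 < t \<longrightarrow> t \<le> b \<longrightarrow> \<rho>0 < infdist (q t) Vm)" for \<epsilon> a b q v w
  have "\<exists>a b q v w. good (\<epsilon> n) a b q v w" for n
    unfolding good_def by (rule ex[OF \<epsilon>])
  then obtain a b q v w where good: "\<And>n. good (\<epsilon> n) (a n) (b n) (q n) (v n) (w n)" by metis
  have ab: "a n \<le> 0" "0 \<le> b n" and m: "motion {a n..b n} (q n) (v n) (w n)"
    and qa: "infdist (q n (a n)) Vm \<le> \<epsilon> n" and qb: "infdist (q n (b n)) Vp \<le> \<epsilon> n"
    and wM: "w n (b n) - w n (a n) \<le> M"
    and farp: "\<And>s. a n \<le> s \<Longrightarrow> s \<le> 0 \<Longrightarrow> \<rho>0 < infdist (q n s) Vp"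
    and farm: "\<And>t. 0 < t \<Longrightarrow> t \<le> b n \<Longrightarrow> \<rho>0 < infdist (q n t) Vm" for n
    using good[of n] unfolding good_def by simp_all
  obtain K where K: "K > 0" "\<And>a b q v w s t. motion {a..b} q v w \<Longrightarrow> s \<in> {a..b} \<Longrightarrow> t \<in> {a..b} \<Longrightarrow> dist (q t) (q s) \<le> K * \<bar>t - s\<bar>"
    by (rule motion_speed) blast
  \<comment> \<open>From one end to the other the distance to \<open>Vp\<close> falls from at least
    two thirds to at most one third of the gap, at speed at most \<open>K\<close>.\<close>
  have \<tau>: "d / (3 * K) \<le> b n - a n" for n
  proof -
    have "2 * d / 3 \<le> infdist (q n (a n)) Vp" using infdist_sum[of "q n (a n)"] qa[of n] \<epsilon>(2)[of n] \<rho>0 by (simp add: d_def)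
    moreover have "infdist (q n (b n)) Vp \<le> d / 3" using qb[of n] \<epsilon>(2)[of n] \<rho>0 by simp
    moreover have "infdist (q n (a n)) Vp \<le> infdist (q n (b n)) Vp + dist (q n (a n)) (q n (b n))" by (rule infdist_triangle)
    moreover have "dist (q n (a n)) (q n (b n)) \<le> K * (b n - a n)" using K(2)[OF m, of "b n" n "a n"] ab[of n] by simp
    ultimately have "d / 3 \<le> K * (b n - a n)" by linarith
    then show ?thesis using K(1) by (simp add: field_simps)
  qed
  have ends: "\<exists>N. \<forall>n\<ge>N. norm (v n (a n)) \<le> e \<and> norm (v n (b n)) \<le> e" if e: "e > 0" for e
  proof -
    have "e\<^sup>2 / 2 > 0" using e by simp
    then obtain r where r: "r > 0" "\<And>x. c < V x \<Longrightarrow> infdist x Vm \<le> r \<or> infdist x Vp \<le> r \<Longrightarrow> V x < c + e\<^sup>2 / 2"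
      by (rule excess_small) blast
    obtain N where N: "\<And>n. n \<ge> N \<Longrightarrow> \<epsilon> n \<le> r" using \<epsilon>0[OF r(1)] by blast
    have small: "norm (v n t) \<le> e" if "t \<in> {a n..b n}" "V (q n t) < c + e\<^sup>2 / 2" for n t
    proof -
      have "(norm (v n t))\<^sup>2 / 2 = V (q n t) - c" using m[of n] that(1) by (simp add: motion_def)
      then have "(norm (v n t))\<^sup>2 \<le> e\<^sup>2" using that(2) by simp
      then show ?thesis using e by (simp add: power2_le_iff_abs_le)
    qed
    have pos: "c < V (q n t)" if "t \<in> {a n..b n}" for n t using m[of n] that by (simp add: motion_def)
    have "norm (v n (a n)) \<le> e \<and> norm (v n (b n)) \<le> e" if "n \<ge> N" for n
    proof
      have I: "a n \<in> {a n..b n}" "b n \<in> {a n..b n}" using ab[of n] by auto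
      show "norm (v n (a n)) \<le> e" using small[OF I(1)] r(2)[OF pos[OF I(1)]] qa[of n] N[OF that] by linarith
      show "norm (v n (b n)) \<le> e" using small[OF I(2)] r(2)[OF pos[OF I(2)]] qb[of n] N[OF that] by linarith
    qed
    then show ?thesis by blast
  qed
  have near: "\<exists>H N. \<forall>n\<ge>N. (\<exists>s. s \<in> {a n..b n} \<and> \<bar>s\<bar> \<le> H \<and> infdist (q n s) Vm \<le> \<rho>) \<and>
     (\<exists>s. s \<in> {a n..b n} \<and> \<bar>s\<bar> \<le> H \<and> infdist (q n s) Vp \<le> \<rho>)" if "\<rho> > 0" for \<rho>
  proof -
    define r where "r = min \<rho> \<rho>0"
    have r: "r > 0" "r \<le> \<rho>" "r \<le> \<rho>0" using that \<rho>0 by (auto simp: r_def)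
    obtain \<mu> where \<mu>: "\<mu> > 0" "\<And>x. r \<le> infdist x Vm \<Longrightarrow> r \<le> infdist x Vp \<Longrightarrow> c + \<mu> \<le> V x"
      by (rule uniform_excess[OF r(1)]) blast
    obtain N where N: "\<And>n. n \<ge> N \<Longrightarrow> \<epsilon> n \<le> r" using \<epsilon>0[OF r(1)] by blast
    \<comment> \<open>Chosen so that staying at excess \<open>\<mu>\<close> for time
      \<open>H\<close> costs more than \<open>M\<close>; the \<open>max\<close> and the summand 1
      make \<open>H\<close> positive and the inequality strict.\<close>
    define H where "H = max 0 (M / \<mu>) + 1"
    have H: "H > 0" "\<mu> * H > M"
    proof -
      show "H > 0" by (simp add: H_def)
      have "M / \<mu> < H" by (simp add: H_def)
      then show "\<mu> * H > M" using \<mu>(1) by (simp add: field_simps)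
    qed
    have near_m: "\<exists>s. s \<in> {a n..b n} \<and> \<bar>s\<bar> \<le> H \<and> infdist (q n s) Vm \<le> \<rho>" if n: "n \<ge> N" for n
    proof (rule ccontr)
      assume no: "\<not> ?thesis"
      then have far: "r < infdist (q n s) Vm" if "s \<in> {a n..b n}" "\<bar>s\<bar> \<le> H" for s
        using that r(2) by (meson not_le order_trans)
      \<comment> \<open>Otherwise the window \<open>[-H, 0]\<close> contains the left endpoint,
        which is \<open>\<epsilon> n\<close>-close to \<open>Vm\<close>.\<close>
      have "a n < - H"
      proof (rule ccontr)
        assume "\<not> ?thesis"
        then have "r < infdist (q n (a n)) Vm" using ab[of n] by (intro far) auto
        then show False using qa[of n] N[OF n] by simp
      qed
      have "\<mu> * (0 - (- H)) \<le> w n 0 - w n (- H)"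
      proof (rule motion_action[OF m])
        fix u assume u: "- H < u" "u < 0"
        then show "c + \<mu> \<le> V (q n u)"
          using far[of u] farp[of n u] \<open>a n < - H\<close> ab[of n] r(3) by (intro \<mu>(2)) auto
      qed (use \<open>a n < - H\<close> ab[of n] H in auto)
      moreover have "w n (a n) \<le> w n (- H)" "w n 0 \<le> w n (b n)"
        using \<open>a n < - H\<close> ab[of n] H(1) by (auto intro!: motion_action_mono[OF m])
      ultimately show False using wM[of n] H(2) by simp
    qed
    have near_p: "\<exists>s. s \<in> {a n..b n} \<and> \<bar>s\<bar> \<le> H \<and> infdist (q n s) Vp \<le> \<rho>" if n: "n \<ge> N" for n
    proof (rule ccontr)
      assume no: "\<not> ?thesis"
      then have far: "r < infdist (q n s) Vp" if "s \<in> {a n..b n}" "\<bar>s\<bar> \<le> H" for s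
        using that r(2) by (meson not_le order_trans)
      have "H < b n"
      proof (rule ccontr)
        assume "\<not> ?thesis"
        then have "r < infdist (q n (b n)) Vp" using ab[of n] by (intro far) auto
        then show False using qb[of n] N[OF n] by simp
      qed
      have "\<mu> * (H - 0) \<le> w n H - w n 0"
      proof (rule motion_action[OF m])
        fix u assume u: "0 < u" "u < H"
        then show "c + \<mu> \<le> V (q n u)"
          using far[of u] farm[of u n] \<open>H < b n\<close> ab[of n] r(3) by (intro \<mu>(2)) auto
      qed (use \<open>H < b n\<close> ab[of n] H in auto)
      moreover have "w n (a n) \<le> w n 0" "w n H \<le> w n (b n)"
        using \<open>H < b n\<close> ab[of n] H(1) by (auto intro!: motion_action_mono[OF m])
      ultimately show False using wM[of n] H(2) by simp
    qed
    show ?thesis using near_m near_p by blast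
  qed
  show thesis
  proof (rule that[of "d / (3 * K)" a b q v w])
    show "d / (3 * K) > 0" using d K by simp
    fix \<rho> :: real assume \<rho>: "\<rho> > 0"
    show "\<exists>H N. \<forall>n\<ge>N. \<exists>s. s \<in> {a n..b n} \<and> \<bar>s\<bar> \<le> H \<and> infdist (q n s) Vm \<le> \<rho>" using near[OF \<rho>] by blast
    show "\<exists>H N. \<forall>n\<ge>N. \<exists>s. s \<in> {a n..b n} \<and> \<bar>s\<bar> \<le> H \<and> infdist (q n s) Vp \<le> \<rho>" using near[OF \<rho>] by blast
  qed (rule m ab \<tau> ends; assumption)+
qed

section \<open>Reflected trajectories and their limit\<close>

text \<open>Reversing time turns a solution \<open>q\<close> with velocity \<open>v\<close> into a
  solution with velocity \<open>- v\<close>. Gluing a trajectory to its reversal keeps the position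
  continuous, and the velocity jumps by twice the end velocity. The lengths \<open>T n\<close> may
  stay bounded or grow without bound; the periodic extension treats both cases at once.\<close>

lemma connecting_solution:
  obtains q v where "\<And>t. (q has_vector_derivative v t) (at t)" "\<And>t. (v has_vector_derivative g (q t)) (at t)"
    "\<And>t. (norm (v t))\<^sup>2 / 2 = V (q t) - c"
    "\<And>\<rho>. \<rho> > 0 \<Longrightarrow> \<exists>t. infdist (q t) Vm \<le> \<rho>" "\<And>\<rho>. \<rho> > 0 \<Longrightarrow> \<exists>t. infdist (q t) Vp \<le> \<rho>"
proof -
  obtain \<tau> a b q v w where \<tau>: "\<tau> > (0::real)"
    and m: "\<And>n. motion {a n..b n} (q n) (v n) (w n)" and ab: "\<And>n::nat. a n \<le> 0" "\<And>n. 0 \<le> b n"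
    and T\<tau>: "\<And>n. \<tau> \<le> b n - a n"
    and ends: "\<And>e. e > 0 \<Longrightarrow> \<exists>N. \<forall>n\<ge>N. norm (v n (a n)) \<le> e \<and> norm (v n (b n)) \<le> e"
    and nearm: "\<And>\<rho>. \<rho> > 0 \<Longrightarrow> \<exists>H N. \<forall>n\<ge>N. \<exists>s. s \<in> {a n..b n} \<and> \<bar>s\<bar> \<le> H \<and> infdist (q n s) Vm \<le> \<rho>"
    and nearp: "\<And>\<rho>. \<rho> > 0 \<Longrightarrow> \<exists>H N. \<forall>n\<ge>N. \<exists>s. s \<in> {a n..b n} \<and> \<bar>s\<bar> \<le> H \<and> infdist (q n s) Vp \<le> \<rho>"
    by (rule connecting_sequence) blast
  obtain R where R: "R > 0" "\<And>x. c < V x \<Longrightarrow> norm x \<le> R" by (rule superlevel_in_ball) blast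
  obtain K where K: "K > 0" "\<And>I q v w t. motion I q v w \<Longrightarrow> t \<in> I \<Longrightarrow> norm (v t) \<le> K"
    by (rule motion_speed) blast
  define T where "T n = b n - a n" for n
  have T: "\<tau> \<le> T n" "T n > 0" for n using T\<tau>[of n] \<tau> by (simp_all add: T_def)
  define F where "F p = (snd p, g (fst p))" for p :: "'a \<times> 'a"
  have F: "continuous_on UNIV F"
    unfolding F_def by (intro continuous_intros continuous_on_compose2[OF g_cont]) auto
  \<comment> \<open>reflection in time at both endpoints, repeated periodically\<close>
  define Y where "Y n k x = (if even k then (q n (x - real_of_int k * T n), v n (x - real_of_int k * T n))
     else (q n (a n + b n - (x - real_of_int k * T n)), - v n (a n + b n - (x - real_of_int k * T n))))" for n :: nat and k :: int and x
  have arg: "x - k * T n \<in> {a n..b n}" "a n + b n - (x - k * T n) \<in> {a n..b n}"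
    if "x \<in> {a n + k * T n..a n + (k + 1) * T n}" for n x k
    using that by (auto simp: T_def algebra_simps)
  have dY: "(Y n k has_vector_derivative F (Y n k x)) (at x within {a n + k * T n..a n + (k + 1) * T n})"
    if x: "x \<in> {a n + k * T n..a n + (real_of_int k + 1) * T n}" for n k x
  proof -
    define I where "I = {a n + real_of_int k * T n..a n + (real_of_int k + 1) * T n}"
    have der: "(q n has_vector_derivative v n u) (at u within {a n..b n})"
      "(v n has_vector_derivative g (q n u)) (at u within {a n..b n})" if "u \<in> {a n..b n}" for u
      using m[of n] that by (simp_all add: motion_def)
    show ?thesis
    proof (cases "even k")
      case True
      have im: "(\<lambda>x. x - k * T n) ` I \<subseteq> {a n..b n}" using arg(1) by (auto simp: I_def)
      have lin: "((\<lambda>x. x - k * T n) has_vector_derivative 1) (at x within I)"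
        by (rule derivative_eq_intros refl | simp)+
      have u: "x - k * T n \<in> {a n..b n}" using arg(1)[OF x] .
      have "Y n k = (\<lambda>x. (q n (x - k * T n), v n (x - k * T n)))" using True by (simp add: Y_def fun_eq_iff)
      then show ?thesis
        using has_vector_derivative_Pair[OF
            vector_diff_chain_within[OF lin has_vector_derivative_within_subset[OF der(1)[OF u] im]]
            vector_diff_chain_within[OF lin has_vector_derivative_within_subset[OF der(2)[OF u] im]]]
        by (simp add: F_def comp_def I_def)
    next
      case False
      have im: "(\<lambda>x. a n + b n - (x - k * T n)) ` I \<subseteq> {a n..b n}" using arg(2) by (auto simp: I_def)
      have lin: "((\<lambda>x. a n + b n - (x - k * T n)) has_vector_derivative -1) (at x within I)"
        by (rule derivative_eq_intros refl | simp)+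
      have u: "a n + b n - (x - k * T n) \<in> {a n..b n}" using arg(2)[OF x] .
      have "Y n k = (\<lambda>x. (q n (a n + b n - (x - k * T n)), - v n (a n + b n - (x - k * T n))))"
        using False by (simp add: Y_def fun_eq_iff)
      then show ?thesis
        using has_vector_derivative_Pair[OF
            vector_diff_chain_within[OF lin has_vector_derivative_within_subset[OF der(1)[OF u] im]]
            has_vector_derivative_minus[OF vector_diff_chain_within[OF lin has_vector_derivative_within_subset[OF der(2)[OF u] im]]]]
        by (simp add: F_def comp_def I_def)
    qed
  qed
  have Yprop: "c < V (fst (Y n k x))" "(norm (snd (Y n k x)))\<^sup>2 / 2 = V (fst (Y n k x)) - c" "norm (snd (Y n k x)) \<le> K"
    if x: "x \<in> {a n + k * T n..a n + (real_of_int k + 1) * T n}" for n k x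
    using arg[OF x] m[of n] K(2)[OF m[of n]] by (auto simp: Y_def motion_def)
  have bY: "norm (Y n k x) \<le> R + K" if x: "x \<in> {a n + k * T n..a n + (real_of_int k + 1) * T n}" for n k x
    using norm_Pair_le[of "fst (Y n k x)" "snd (Y n k x)"] R(2)[OF Yprop(1)[OF x]] Yprop(3)[OF x] by simp
  have jump: "\<exists>N. \<forall>n\<ge>N. \<forall>k. norm (Y n (k + 1) (a n + (real_of_int k + 1) * T n) - Y n k (a n + (real_of_int k + 1) * T n)) \<le> e"
    if "e > 0" for e
  proof -
    have "e / 2 > 0" using that by simp
    from ends[OF this] obtain N where N: "\<And>n. n \<ge> N \<Longrightarrow> norm (v n (a n)) \<le> e/2 \<and> norm (v n (b n)) \<le> e/2" by blast
    have "norm (Y n (k + 1) (a n + (real_of_int k + 1) * T n) - Y n k (a n + (real_of_int k + 1) * T n)) \<le> e" if n: "n \<ge> N" for n k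
    proof -
      \<comment> \<open>At \<open>p\<close> an even piece and its odd successor both have reached
        the original time \<open>b n\<close>, whereas an odd piece and its even successor meet at
        \<open>a n\<close>.\<close>
      define p where "p = a n + (real_of_int k + 1) * T n"
      have p1: "p - real_of_int (k + 1) * T n = a n" "p - real_of_int k * T n = b n"
        by (simp_all add: p_def T_def algebra_simps)
      have two: "norm (- x - x) = 2 * norm x" "norm (x - - x) = 2 * norm x" for x :: 'a
        by (metis norm_minus_cancel minus_diff_eq mult_2 norm_scaleR scaleR_2 abs_numeral diff_minus_eq_add add_uminus_conv_diff minus_add_distrib)+
      have n0: "norm (0::'a, x) = norm x" for x :: 'a by (simp add: norm_Pair)
      have "norm (Y n (k + 1) p - Y n k p) \<le> e"
      proof (cases "even k")
        case True
        then have "Y n (k + 1) p - Y n k p = (0, - v n (b n) - v n (b n))"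
          unfolding Y_def p1 by simp
        then show ?thesis using N[OF n] two(1)[of "v n (b n)"] by (simp add: n0)
      next
        case False
        then have "Y n (k + 1) p - Y n k p = (0, v n (a n) - - v n (a n))"
          unfolding Y_def p1 by simp
        then show ?thesis using N[OF n] two(2)[of "v n (a n)"] by (simp add: n0)
      qed
      then show ?thesis by (simp add: p_def)
    qed
    then show ?thesis by blast
  qed
  define y where "y n t = Y n \<lfloor>(t - a n) / T n\<rfloor> t" for n t
  obtain r z where r: "strict_mono (r :: nat \<Rightarrow> nat)"
    and lim: "\<And>l x s. strict_mono l \<Longrightarrow> x \<longlonglongrightarrow> s \<Longrightarrow> (\<lambda>n. y (r (l n)) (x n)) \<longlonglongrightarrow> z s"
    and z: "\<And>t. (z has_vector_derivative F (z t)) (at t)"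
  proof (rule piecewise_solution_limit[OF F \<tau> T(1) dY bY jump])
    fix r :: "nat \<Rightarrow> nat" and z
    assume r: "strict_mono r" and z: "\<And>t. (z has_vector_derivative F (z t)) (at t)"
      and lim: "\<And>l x s. strict_mono l \<Longrightarrow> x \<longlonglongrightarrow> s \<Longrightarrow>
        (\<lambda>n. Y (r (l n)) \<lfloor>(x n - a (r (l n))) / T (r (l n))\<rfloor> (x n)) \<longlonglongrightarrow> z s"
    show ?thesis
      by (rule that[of r z, unfolded y_def]) (rule r lim z; assumption)+
  qed
  define Q where "Q t = fst (z t)" for t
  define U where "U t = snd (z t)" for t
  have dQ: "(Q has_vector_derivative U t) (at t)" and dU: "(U has_vector_derivative g (Q t)) (at t)" for t
    using bounded_linear.has_vector_derivative[OF bounded_linear_fst z[of t]] bounded_linear.has_vector_derivative[OF bounded_linear_snd z[of t]]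
    by (simp_all add: Q_def[abs_def] U_def[abs_def] F_def)
  \<comment> \<open>The identity involves only the square of the velocity, so reflected pieces
    satisfy it too. In the limit \<open>c < V\<close> weakens to \<open>c \<le> V\<close>, and
    points of rest may occur.\<close>
  have en: "(norm (U t))\<^sup>2 / 2 = V (Q t) - c" for t
  proof -
    have yt: "(\<lambda>n. y (r n) t) \<longlonglongrightarrow> z t" using lim[of "\<lambda>n. n" "\<lambda>_. t" t] by (simp add: strict_mono_def)
    have eq: "(norm (snd (y n t)))\<^sup>2 / 2 = V (fst (y n t)) - c" for n
      unfolding y_def by (rule Yprop(2)) (use floor_cell[OF T(2)] in simp)
    have "(\<lambda>n. (norm (snd (y (r n) t)))\<^sup>2 / 2) \<longlonglongrightarrow> (norm (U t))\<^sup>2 / 2"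
      unfolding U_def by (intro tendsto_intros yt) simp
    moreover have "(\<lambda>n. V (fst (y (r n) t))) \<longlonglongrightarrow> V (Q t)"
      unfolding Q_def by (rule continuous_on_tendsto_compose[OF V_cont[of UNIV]]) (auto intro: tendsto_fst yt)
    then have "(\<lambda>n. V (fst (y (r n) t)) - c) \<longlonglongrightarrow> V (Q t) - c" by (intro tendsto_intros)
    ultimately show ?thesis unfolding eq by (rule LIMSEQ_unique)
  qed
  \<comment> \<open>At the right endpoint the floor is already 1, which selects the reflected piece;
    its position agrees there, only its velocity has the opposite sign.\<close>
  have yq: "fst (y n s) = q n s" if s: "s \<in> {a n..b n}" for n s
  proof (cases "s = b n")
    case True
    then have "\<lfloor>(s - a n) / T n\<rfloor> = 1" using T(2)[of n] by (simp add: T_def)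
    then show ?thesis using True by (simp add: y_def Y_def T_def)
  next
    case False
    then have "\<lfloor>(s - a n) / T n\<rfloor> = 0" using T(2)[of n] s by (simp add: floor_eq_iff T_def)
    then show ?thesis by (simp add: y_def Y_def)
  qed
  \<comment> \<open>The times of approach are bounded, hence converge along a further subsequence
    \<open>l\<close>, and convergence at moving times carries the closeness over to the limit. The
    shift by \<open>N\<close> discards the indices at which closeness is not yet known.\<close>
  have near: "\<exists>t. infdist (Q t) A \<le> \<rho>"
    if ex: "\<exists>H N. \<forall>n\<ge>N. \<exists>s. s \<in> {a n..b n} \<and> \<bar>s\<bar> \<le> H \<and> infdist (q n s) A \<le> \<rho>" for A \<rho>
  proof -
    obtain H N where HN: "\<And>n. n \<ge> N \<Longrightarrow> \<exists>s. s \<in> {a n..b n} \<and> \<bar>s\<bar> \<le> H \<and> infdist (q n s) A \<le> \<rho>"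
      using ex by blast
    have "r (N + n) \<ge> N" for n using seq_suble[OF r, of "N + n"] by simp
    then have "\<exists>s. s \<in> {a (r (N + n))..b (r (N + n))} \<and> \<bar>s\<bar> \<le> H \<and> infdist (q (r (N + n)) s) A \<le> \<rho>" for n
      by (rule HN)
    then obtain s where s: "\<And>n. s n \<in> {a (r (N + n))..b (r (N + n))}" "\<And>n. \<bar>s n\<bar> \<le> H"
      "\<And>n. infdist (q (r (N + n)) (s n)) A \<le> \<rho>" by metis
    have "s n \<in> {- H..H}" for n using s(2)[of n] by (auto simp: abs_le_iff)
    then obtain s0 l where l: "strict_mono (l :: nat \<Rightarrow> nat)" and s0: "(s \<circ> l) \<longlonglongrightarrow> s0"
      using compact_Icc[of "- H" H] unfolding compact_def by metis
    have "strict_mono (\<lambda>n. N + l n)" using l by (simp add: strict_mono_def)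
    from lim[OF this s0] have "(\<lambda>n. y (r (N + l n)) (s (l n))) \<longlonglongrightarrow> z s0" by (simp add: comp_def)
    then have "(\<lambda>n. infdist (fst (y (r (N + l n)) (s (l n)))) A) \<longlonglongrightarrow> infdist (Q s0) A"
      unfolding Q_def by (intro tendsto_infdist tendsto_fst)
    moreover have "infdist (fst (y (r (N + l n)) (s (l n)))) A \<le> \<rho>" for n
      using s(3)[of "l n"] by (simp only: yq[OF s(1)])
    ultimately have "infdist (Q s0) A \<le> \<rho>" by (intro LIMSEQ_le_const2) auto
    then show ?thesis ..
  qed
  show thesis
  proof (rule that[of Q U])
    show "\<exists>t. infdist (Q t) Vm \<le> \<rho>" if "\<rho> > 0" for \<rho> by (intro near nearm that)
    show "\<exists>t. infdist (Q t) Vp \<le> \<rho>" if "\<rho> > 0" for \<rho> by (intro near nearp that)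
  qed (rule dQ dU en)+
qed

end

section \<open>The solution in the terms of the statement\<close>

lemma INF_infdist_eq_0:
  fixes q :: "'b \<Rightarrow> 'a::metric_space"
  assumes "\<And>\<rho>. \<rho> > 0 \<Longrightarrow> \<exists>t. infdist (q t) A \<le> \<rho>"
  shows "(INF t. infdist (q t) A) = 0"
proof (rule antisym)
  have bdd: "bdd_below (range (\<lambda>t. infdist (q t) A))" by (rule bdd_belowI[of _ 0]) (auto simp: infdist_nonneg)
  show "(INF t. infdist (q t) A) \<le> 0"
  proof (rule field_le_epsilon)
    fix e :: real assume "e > 0"
    then obtain t where "infdist (q t) A \<le> e" using assms by blast
    then show "(INF t. infdist (q t) A) \<le> 0 + e" using cINF_lower[OF bdd, of t] by simp
  qed
  show "0 \<le> (INF t. infdist (q t) A)" by (rule cINF_greatest) (auto simp: infdist_nonneg)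
qed

theorem proposition3p5:
  fixes V :: "real ^ 'n \<Rightarrow> real"
    and c :: real
    and Vm Vp :: "(real ^ 'n) set"
  assumes dim: "CARD('n) \<ge> 2"
    and C1: "C1_scalar V"
    and V3: "V 0 = 0" "\<exists>r0>0. \<forall>x \<in> closure (ball 0 (4 * r0)) - {0}. V x > 0"
    and V4: "bounded (core V)" "\<forall>x \<in> frontier (core V). grad V x \<noteq> 0"
    and c: "c \<ge> 0"
    and Vc: "sublevel_splitting V c Vm Vp"
  shows "\<exists>q :: real \<Rightarrow> real ^ 'n.
    C2_curve q \<and>
    (\<forall>t. velocity (velocity q) t = grad V (q t)) \<and>
    (INF t. infdist (q t) Vm) = 0 \<and>
    (INF t. infdist (q t) Vp) = 0 \<and>
    (\<forall>t. energy V q t = - c)"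
proof -
  interpret split_sublevel V "grad V" c Vm Vp
  proof
    \<comment> \<open>For \<open>c \<ge> 0\<close> the superlevel set is contained in
      \<open>core V\<close>.\<close>
    show "bounded {x. c < V x}" by (rule bounded_subset[OF V4(1)]) (use c in \<open>auto simp: core_def\<close>)
    show "{x. V x \<le> c} = Vm \<union> Vp" using Vc unfolding sublevel_splitting_def sublevel_def by simp
  qed (use C1 Vc in \<open>simp_all add: C1_scalar_def sublevel_splitting_def\<close>)
  obtain q v where dq: "\<And>t. (q has_vector_derivative v t) (at t)"
    and dv: "\<And>t. (v has_vector_derivative grad V (q t)) (at t)"
    and en: "\<And>t. (norm (v t))\<^sup>2 / 2 = V (q t) - c"
    and near: "\<And>\<rho>. \<rho> > 0 \<Longrightarrow> \<exists>t. infdist (q t) Vm \<le> \<rho>" "\<And>\<rho>. \<rho> > 0 \<Longrightarrow> \<exists>t. infdist (q t) Vp \<le> \<rho>"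
    by (rule connecting_solution) blast
  have vel: "velocity q = v" using vector_derivative_at[OF dq] by (simp add: velocity_def fun_eq_iff)
  have vel2: "velocity v t = grad V (q t)" for t using vector_derivative_at[OF dv] by (simp add: velocity_def)
  have cont: "continuous_on UNIV q" "continuous_on UNIV v"
    using dq dv by (meson continuous_at_imp_continuous_on has_vector_derivative_continuous)+
  have cont': "continuous_on UNIV (\<lambda>t. grad V (q t))"
    by (rule continuous_on_compose2[OF g_cont cont(1)]) simp
  have "q C1_differentiable_on UNIV"
    unfolding C1_differentiable_on_def by (intro exI[of _ v] conjI ballI dq cont(2))
  moreover have "v C1_differentiable_on UNIV"
    unfolding C1_differentiable_on_def by (intro exI[of _ "\<lambda>t. grad V (q t)"] conjI ballI dv cont')
  ultimately have "C2_curve q"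
    by (simp add: C2_curve_def vel)
  moreover have "energy V q t = - c" for t using en[of t] unfolding energy_def vel by linarith
  ultimately show ?thesis
    using vel vel2 INF_infdist_eq_0[OF near(1)] INF_infdist_eq_0[OF near(2)] by (intro exI[of _ q]) simp
qed

end
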